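(* Let $\Lambda$ be a finite set with more than one element, $X=\Lambda^{\mathbb{Z}}$, $\sigma$ the shift on $X$, and $\mu=\prod_{\mathbb{Z}}\mu_1$, where $\mu_1$ is a probability measure on $\Lambda$ with $\mu_1(\{\lambda\})>0$ for all $\lambda\in\Lambda$. Then the automorphism $\alpha$ of $L^\infty(X,\mu)$ induced by $\sigma$ satisfies $L^\infty(X,\mu)^\alpha=\mathbb{C}1$. If moreover $n$ is an integer greater than $1$, $C_1$ is a non-empty proper subset of $\Lambda$, $C=\{x\in X : x_0\in C_1\}$, $D=X\setminus C$, and $$W=\chi_C\otimes u^*+\chi_D\otimes v^*\in L^\infty(X,\mu)\otimes M_n,$$ then the automorphism $\beta=\mathrm{Ad}\,W\circ(\alpha\otimes\mathrm{id})$ of $L^\infty(X,\mu)\otimes M_n$ satisfies $(L^\infty(X,\mu)\otimes M_n)^\beta=\mathbb{C}1$.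
   Context: $\sigma$ is the shift to the right, $\sigma(x)_i=x_{i-1}$, and $\alpha(f)=f\circ\sigma^{-1}$. $M_n$ is the algebra of complex $n\times n$ matrices, $\omega=e^{2\pi i/n}$, $u=\mathrm{diag}(1,\omega,\dots,\omega^{n-1})\in M_n$, and $v\in M_n$ is the cyclic shift permutation unitary with $vuv^*=\omega u$ (so $u^n=v^n=1$). $\chi_S$ is the characteristic function of $S$, $\mathrm{Ad}\,W(T)=WTW^*$, and a superscript $\alpha$ or $\beta$ denotes the fixed point algebra. *)

theory Defs
  imports "HOL-Probability.Probability" "Jordan_Normal_Form.Schur_Decomposition"
begin

section \<open>Star algebras of functions modulo almost everywhere equality\<close>

record 'a star_algebra = "(complex, 'a) module" +
  star :: "'a \<Rightarrow> 'a"

definition complex_algebra :: "complex star_algebra" where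
  "complex_algebra = \<lparr>carrier = UNIV, mult = (*), one = 1, zero = 0, add = (+),
     smult = (*), star = cnj\<rparr>"

definition mat_algebra :: "nat \<Rightarrow> complex mat star_algebra" where
  "mat_algebra n = \<lparr>carrier = carrier_mat n n, mult = (*), one = 1\<^sub>m n, zero = 0\<^sub>m n n,
     add = (+), smult = (\<cdot>\<^sub>m), star = mat_adjoint\<rparr>"

definition ae_class :: "'x measure \<Rightarrow> ('x \<Rightarrow> 'b) set \<Rightarrow> ('x \<Rightarrow> 'b) \<Rightarrow> ('x \<Rightarrow> 'b) set" where
  "ae_class M S f = {g \<in> S. AE x in M. f x = g x}"

text \<open>The quotient by almost everywhere equality of a set \<open>S\<close> of \<open>B\<close>-valued functions that is closed
  under the pointwise operations. Operations on classes are defined as unions over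
  representatives; all the sets in such a union coincide.\<close>

definition ae_algebra ::
    "'x measure \<Rightarrow> ('x \<Rightarrow> 'b) set \<Rightarrow> 'b star_algebra \<Rightarrow> ('x \<Rightarrow> 'b) set star_algebra" where
  "ae_algebra M S B =
    \<lparr>carrier = ae_class M S ` S,
     mult = (\<lambda>a b. \<Union>f\<in>a. \<Union>g\<in>b. ae_class M S (\<lambda>x. f x \<otimes>\<^bsub>B\<^esub> g x)),
     one = ae_class M S (\<lambda>_. \<one>\<^bsub>B\<^esub>),
     zero = ae_class M S (\<lambda>_. \<zero>\<^bsub>B\<^esub>),
     add = (\<lambda>a b. \<Union>f\<in>a. \<Union>g\<in>b. ae_class M S (\<lambda>x. f x \<oplus>\<^bsub>B\<^esub> g x)),
     smult = (\<lambda>c a. \<Union>f\<in>a. ae_class M S (\<lambda>x. c \<odot>\<^bsub>B\<^esub> f x)),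
     star = (\<lambda>a. \<Union>f\<in>a. ae_class M S (\<lambda>x. star B (f x)))\<rparr>"

definition Linf_fun :: "'x measure \<Rightarrow> ('x \<Rightarrow> complex) set" where
  "Linf_fun M = {f \<in> borel_measurable M. \<exists>K. AE x in M. norm (f x) \<le> K}"

definition Linf :: "'x measure \<Rightarrow> ('x \<Rightarrow> complex) set star_algebra" where
  "Linf M = ae_algebra M (Linf_fun M) complex_algebra"

text \<open>As \<open>M\<^sub>n\<close> is finite-dimensional, the tensor product of the algebra \<open>L\<^sup>\<infinity>\<close> with \<open>M\<^sub>n\<close> is realised as the
  algebra of essentially bounded measurable \<open>M\<^sub>n\<close>-valued functions modulo almost everywhere
  equality; see \<open>entry_bij\<close> and \<open>entry_tensor\<close> below. In finite dimension, measurability and essential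
  boundedness may be tested on the entries.\<close>

definition Linf_mat_fun :: "'x measure \<Rightarrow> nat \<Rightarrow> ('x \<Rightarrow> complex mat) set" where
  "Linf_mat_fun M n = {F. (\<forall>x\<in>space M. F x \<in> carrier_mat n n) \<and>
     (\<forall>i<n. \<forall>j<n. (\<lambda>x. F x $$ (i, j)) \<in> Linf_fun M)}"

definition Linf_mat :: "'x measure \<Rightarrow> nat \<Rightarrow> ('x \<Rightarrow> complex mat) set star_algebra" where
  "Linf_mat M n = ae_algebra M (Linf_mat_fun M n) (mat_algebra n)"

abbreviation Linf_class :: "'x measure \<Rightarrow> ('x \<Rightarrow> complex) \<Rightarrow> ('x \<Rightarrow> complex) set" where
  "Linf_class M \<equiv> ae_class M (Linf_fun M)"

abbreviation Linf_mat_class ::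
    "'x measure \<Rightarrow> nat \<Rightarrow> ('x \<Rightarrow> complex mat) \<Rightarrow> ('x \<Rightarrow> complex mat) set" where
  "Linf_mat_class M n \<equiv> ae_class M (Linf_mat_fun M n)"

text \<open>The elementary tensor of a class and a matrix.\<close>

definition tensor ::
    "'x measure \<Rightarrow> nat \<Rightarrow> ('x \<Rightarrow> complex) set \<Rightarrow> complex mat \<Rightarrow> ('x \<Rightarrow> complex mat) set" where
  "tensor M n a A = (\<Union>f\<in>a. Linf_mat_class M n (\<lambda>x. f x \<cdot>\<^sub>m A))"

definition entry ::
    "'x measure \<Rightarrow> ('x \<Rightarrow> complex mat) set \<Rightarrow> nat \<Rightarrow> nat \<Rightarrow> ('x \<Rightarrow> complex) set" where
  "entry M T i j = (\<Union>F\<in>T. Linf_class M (\<lambda>x. F x $$ (i, j)))"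

text \<open>The map \<open>\<phi> \<otimes> id\<close>: the \<open>(i, j)\<close> entry of \<open>(\<phi> \<otimes> id) T\<close> is \<open>\<phi>\<close> of the \<open>(i, j)\<close> entry of \<open>T\<close>.\<close>

definition tensor_id ::
    "'x measure \<Rightarrow> nat \<Rightarrow> (('x \<Rightarrow> complex) set \<Rightarrow> ('x \<Rightarrow> complex) set) \<Rightarrow>
      ('x \<Rightarrow> complex mat) set \<Rightarrow> ('x \<Rightarrow> complex mat) set" where
  "tensor_id M n \<phi> T =
     {F \<in> Linf_mat_fun M n. \<forall>i<n. \<forall>j<n. (\<lambda>x. F x $$ (i, j)) \<in> \<phi> (entry M T i j)}"

definition Ad :: "('a, 'm) star_algebra_scheme \<Rightarrow> 'a \<Rightarrow> 'a \<Rightarrow> 'a" where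
  "Ad A w t = w \<otimes>\<^bsub>A\<^esub> t \<otimes>\<^bsub>A\<^esub> star A w"

definition fixed_points :: "('a, 'm) star_algebra_scheme \<Rightarrow> ('a \<Rightarrow> 'a) \<Rightarrow> 'a set" where
  "fixed_points A \<phi> = {a \<in> carrier A. \<phi> a = a}"

definition scalars :: "('a, 'm) star_algebra_scheme \<Rightarrow> 'a set" where
  "scalars A = {c \<odot>\<^bsub>A\<^esub> \<one>\<^bsub>A\<^esub> | c. True}"

definition star_automorphism :: "('a, 'm) star_algebra_scheme \<Rightarrow> ('a \<Rightarrow> 'a) \<Rightarrow> bool" where
  "star_automorphism A \<phi> \<longleftrightarrow> bij_betw \<phi> (carrier A) (carrier A) \<and> \<phi> \<one>\<^bsub>A\<^esub> = \<one>\<^bsub>A\<^esub> \<and>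
     (\<forall>a\<in>carrier A. \<forall>b\<in>carrier A. \<phi> (a \<oplus>\<^bsub>A\<^esub> b) = \<phi> a \<oplus>\<^bsub>A\<^esub> \<phi> b \<and>
        \<phi> (a \<otimes>\<^bsub>A\<^esub> b) = \<phi> a \<otimes>\<^bsub>A\<^esub> \<phi> b) \<and>
     (\<forall>a\<in>carrier A. \<phi> (star A a) = star A (\<phi> a) \<and> (\<forall>c. \<phi> (c \<odot>\<^bsub>A\<^esub> a) = c \<odot>\<^bsub>A\<^esub> \<phi> a))"


section \<open>The Bernoulli shift and its matrix extension\<close>

definition bernoulli :: "'a measure \<Rightarrow> (int \<Rightarrow> 'a) measure" where
  "bernoulli \<mu>1 = Pi\<^sub>M UNIV (\<lambda>_. \<mu>1)"

definition shift :: "(int \<Rightarrow> 'a) \<Rightarrow> int \<Rightarrow> 'a" where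
  "shift x = (\<lambda>i. x (i - 1))"

definition alpha ::
    "'a measure \<Rightarrow> ((int \<Rightarrow> 'a) \<Rightarrow> complex) set \<Rightarrow> ((int \<Rightarrow> 'a) \<Rightarrow> complex) set" where
  "alpha \<mu>1 a = (\<Union>f\<in>a. Linf_class (bernoulli \<mu>1) (f \<circ> inv_into UNIV shift))"

definition clock_root :: "nat \<Rightarrow> complex" where
  "clock_root n = exp (2 * of_real pi * \<i> / of_nat n)"

definition clock_mat :: "nat \<Rightarrow> complex mat" where
  "clock_mat n = mat n n (\<lambda>(i, j). if i = j then clock_root n ^ i else 0)"

text \<open>The direction of the cyclic shift is the one determined by \<open>v u v\<^sup>* = \<omega> u\<close>; see
  \<open>shift_mat_clock_mat\<close> below.\<close>

definition shift_mat :: "nat \<Rightarrow> complex mat" where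
  "shift_mat n = mat n n (\<lambda>(i, j). if j = (i + 1) mod n then 1 else 0)"

definition cocycle_unitary ::
    "'x measure \<Rightarrow> nat \<Rightarrow> 'x set \<Rightarrow> 'x set \<Rightarrow> ('x \<Rightarrow> complex mat) set" where
  "cocycle_unitary M n C D =
     tensor M n (Linf_class M (indicator C)) (mat_adjoint (clock_mat n)) \<oplus>\<^bsub>Linf_mat M n\<^esub>
     tensor M n (Linf_class M (indicator D)) (mat_adjoint (shift_mat n))"

definition beta ::
    "'a measure \<Rightarrow> nat \<Rightarrow> (int \<Rightarrow> 'a) set \<Rightarrow> (int \<Rightarrow> 'a) set \<Rightarrow>
      ((int \<Rightarrow> 'a) \<Rightarrow> complex mat) set \<Rightarrow> ((int \<Rightarrow> 'a) \<Rightarrow> complex mat) set" where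
  "beta \<mu>1 n C D =
     Ad (Linf_mat (bernoulli \<mu>1) n) (cocycle_unitary (bernoulli \<mu>1) n C D) \<circ>
     tensor_id (bernoulli \<mu>1) n (alpha \<mu>1)"

section \<open>Basic properties\<close>

lemma ae_class_cong: "AE x in M. f x = g x \<Longrightarrow> ae_class M S f = ae_class M S g"
  unfolding ae_class_def by (intro Collect_cong conj_cong refl iffI) (auto elim: eventually_elim2)

lemma ae_class_eq_iff:
  assumes "f \<in> S" "g \<in> S"
  shows "ae_class M S f = ae_class M S g \<longleftrightarrow> (AE x in M. f x = g x)"
proof
  assume "ae_class M S f = ae_class M S g"
  moreover have "g \<in> ae_class M S g" using assms by (simp add: ae_class_def)
  ultimately have "g \<in> ae_class M S f" by simp
  then show "AE x in M. f x = g x" by (simp add: ae_class_def)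
qed (rule ae_class_cong)

lemma UN_ae_class:
  assumes "f \<in> S" "\<And>g. g \<in> S \<Longrightarrow> AE x in M. f x = g x \<Longrightarrow> h g = h f"
  shows "(\<Union>g\<in>ae_class M S f. h g) = h f"
proof -
  have "f \<in> ae_class M S f" using assms(1) by (simp add: ae_class_def)
  moreover have "h g = h f" if "g \<in> ae_class M S f" for g
    using that assms(2) by (simp add: ae_class_def)
  ultimately show ?thesis by blast
qed

lemma UN2_ae_class:
  assumes "f \<in> S" "g \<in> S"
  shows "(\<Union>f'\<in>ae_class M S f. \<Union>g'\<in>ae_class M S g. ae_class M S (\<lambda>x. k (f' x) (g' x))) =
    ae_class M S (\<lambda>x. k (f x) (g x))"
proof -
  have 1: "(\<Union>g'\<in>ae_class M S g. ae_class M S (\<lambda>x. k (f' x) (g' x))) =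
      ae_class M S (\<lambda>x. k (f' x) (g x))" for f'
    by (rule UN_ae_class[OF assms(2)], rule ae_class_cong) (auto elim: eventually_mono)
  show ?thesis unfolding 1
    by (rule UN_ae_class[OF assms(1)], rule ae_class_cong) (auto elim: eventually_mono)
qed

lemma ae_algebra_class:
  assumes "f \<in> S" "g \<in> S"
  shows "ae_class M S f \<otimes>\<^bsub>ae_algebra M S B\<^esub> ae_class M S g = ae_class M S (\<lambda>x. f x \<otimes>\<^bsub>B\<^esub> g x)"
    and "ae_class M S f \<oplus>\<^bsub>ae_algebra M S B\<^esub> ae_class M S g = ae_class M S (\<lambda>x. f x \<oplus>\<^bsub>B\<^esub> g x)"
    and "c \<odot>\<^bsub>ae_algebra M S B\<^esub> ae_class M S f = ae_class M S (\<lambda>x. c \<odot>\<^bsub>B\<^esub> f x)"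
    and "star (ae_algebra M S B) (ae_class M S f) = ae_class M S (\<lambda>x. star B (f x))"
proof -
  show "c \<odot>\<^bsub>ae_algebra M S B\<^esub> ae_class M S f = ae_class M S (\<lambda>x. c \<odot>\<^bsub>B\<^esub> f x)"
    unfolding ae_algebra_def module.simps
    by (rule UN_ae_class[OF assms(1)], rule ae_class_cong) (auto elim: eventually_mono)
  show "star (ae_algebra M S B) (ae_class M S f) = ae_class M S (\<lambda>x. star B (f x))"
    unfolding ae_algebra_def star_algebra.simps
    by (rule UN_ae_class[OF assms(1)], rule ae_class_cong) (auto elim: eventually_mono)
qed (simp_all add: ae_algebra_def UN2_ae_class[OF assms])

definition pointwise_closed :: "('x \<Rightarrow> 'b) set \<Rightarrow> 'b star_algebra \<Rightarrow> bool" where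
  "pointwise_closed S B \<longleftrightarrow> (\<lambda>_. \<one>\<^bsub>B\<^esub>) \<in> S \<and> (\<lambda>_. \<zero>\<^bsub>B\<^esub>) \<in> S \<and>
     (\<forall>f\<in>S. \<forall>g\<in>S. (\<lambda>x. f x \<otimes>\<^bsub>B\<^esub> g x) \<in> S \<and> (\<lambda>x. f x \<oplus>\<^bsub>B\<^esub> g x) \<in> S) \<and>
     (\<forall>f\<in>S. (\<lambda>x. star B (f x)) \<in> S \<and> (\<forall>c. (\<lambda>x. c \<odot>\<^bsub>B\<^esub> f x) \<in> S))"

lemma star_automorphism_ae_algebraI:
  assumes cl: "pointwise_closed S B"
    and \<phi>: "\<And>f. f \<in> S \<Longrightarrow> \<phi> (ae_class M S f) = ae_class M S (\<Phi> f)"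
    and in_S: "\<And>f. f \<in> S \<Longrightarrow> \<Phi> f \<in> S" "\<And>f. f \<in> S \<Longrightarrow> \<Psi> f \<in> S"
    and surj: "\<And>f. f \<in> S \<Longrightarrow> AE x in M. \<Phi> (\<Psi> f) x = f x"
    and inj: "\<And>f g. f \<in> S \<Longrightarrow> g \<in> S \<Longrightarrow> AE x in M. \<Phi> f x = \<Phi> g x \<Longrightarrow> AE x in M. f x = g x"
    and one: "AE x in M. \<Phi> (\<lambda>_. \<one>\<^bsub>B\<^esub>) x = \<one>\<^bsub>B\<^esub>"
    and hom: "\<And>f g. f \<in> S \<Longrightarrow> g \<in> S \<Longrightarrow> AE x in M. \<Phi> (\<lambda>x. f x \<oplus>\<^bsub>B\<^esub> g x) x = \<Phi> f x \<oplus>\<^bsub>B\<^esub> \<Phi> g x"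
      "\<And>f g. f \<in> S \<Longrightarrow> g \<in> S \<Longrightarrow> AE x in M. \<Phi> (\<lambda>x. f x \<otimes>\<^bsub>B\<^esub> g x) x = \<Phi> f x \<otimes>\<^bsub>B\<^esub> \<Phi> g x"
      "\<And>f. f \<in> S \<Longrightarrow> AE x in M. \<Phi> (\<lambda>x. star B (f x)) x = star B (\<Phi> f x)"
      "\<And>f c. f \<in> S \<Longrightarrow> AE x in M. \<Phi> (\<lambda>x. c \<odot>\<^bsub>B\<^esub> f x) x = c \<odot>\<^bsub>B\<^esub> \<Phi> f x"
  shows "star_automorphism (ae_algebra M S B) \<phi>"
proof -
  have car: "carrier (ae_algebra M S B) = ae_class M S ` S"
    and one': "\<one>\<^bsub>ae_algebra M S B\<^esub> = ae_class M S (\<lambda>_. \<one>\<^bsub>B\<^esub>)"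
    by (simp_all add: ae_algebra_def)
  have bij: "bij_betw \<phi> (ae_class M S ` S) (ae_class M S ` S)"
  proof (rule bij_betw_imageI)
    show "inj_on \<phi> (ae_class M S ` S)"
      by (rule inj_onI, elim imageE) (simp add: \<phi> in_S ae_class_eq_iff inj)
    show "\<phi> ` ae_class M S ` S = ae_class M S ` S"
    proof
      show "\<phi> ` ae_class M S ` S \<subseteq> ae_class M S ` S" using \<phi> in_S by auto
      show "ae_class M S ` S \<subseteq> \<phi> ` ae_class M S ` S"
      proof
        fix a assume "a \<in> ae_class M S ` S"
        then obtain f where f: "f \<in> S" "a = ae_class M S f" by auto
        have "\<phi> (ae_class M S (\<Psi> f)) = ae_class M S (\<Phi> (\<Psi> f))" using f in_S \<phi> by auto
        also have "\<dots> = a" unfolding f(2) by (rule ae_class_cong[OF surj[OF f(1)]])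
        finally show "a \<in> \<phi> ` ae_class M S ` S" using in_S f by (metis imageI)
      qed
    qed
  qed
  show ?thesis
    unfolding star_automorphism_def car one'
  proof (intro conjI ballI allI)
    show "\<phi> (ae_class M S (\<lambda>_. \<one>\<^bsub>B\<^esub>)) = ae_class M S (\<lambda>_. \<one>\<^bsub>B\<^esub>)"
      using cl unfolding pointwise_closed_def by (simp add: \<phi> ae_class_cong[OF one])
  next
    fix a b assume "a \<in> ae_class M S ` S" "b \<in> ae_class M S ` S"
    then obtain f g where fg: "f \<in> S" "g \<in> S" "a = ae_class M S f" "b = ae_class M S g" by auto
    show "\<phi> (a \<oplus>\<^bsub>ae_algebra M S B\<^esub> b) = \<phi> a \<oplus>\<^bsub>ae_algebra M S B\<^esub> \<phi> b"
      "\<phi> (a \<otimes>\<^bsub>ae_algebra M S B\<^esub> b) = \<phi> a \<otimes>\<^bsub>ae_algebra M S B\<^esub> \<phi> b"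
      using cl fg unfolding pointwise_closed_def
      by (simp_all add: ae_algebra_class \<phi> in_S hom ae_class_cong)
  next
    fix a c assume "a \<in> ae_class M S ` S"
    then obtain f where f: "f \<in> S" "a = ae_class M S f" by auto
    show "\<phi> (star (ae_algebra M S B) a) = star (ae_algebra M S B) (\<phi> a)"
      "\<phi> (c \<odot>\<^bsub>ae_algebra M S B\<^esub> a) = c \<odot>\<^bsub>ae_algebra M S B\<^esub> \<phi> a"
      using cl f unfolding pointwise_closed_def
      by (simp_all add: ae_algebra_class[OF _ f(1)] ae_algebra_class \<phi> in_S hom ae_class_cong)
  qed (rule bij)
qed

lemma Linf_funI:
  "f \<in> borel_measurable M \<Longrightarrow> AE x in M. norm (f x) \<le> K \<Longrightarrow> f \<in> Linf_fun M"
  by (auto simp: Linf_fun_def)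

lemma Linf_fun_cong: "(\<And>x. x \<in> space M \<Longrightarrow> f x = g x) \<Longrightarrow> f \<in> Linf_fun M \<longleftrightarrow> g \<in> Linf_fun M"
  unfolding Linf_fun_def by (simp cong: measurable_cong AE_cong)

lemma Linf_fun_const: "(\<lambda>_. c) \<in> Linf_fun M"
  by (rule Linf_funI[of _ _ "norm c"]) auto

lemma Linf_fun_add: 
  assumes "f \<in> Linf_fun M" "g \<in> Linf_fun M" 
  shows "(\<lambda>x. f x + g x) \<in> Linf_fun M"
proof -
  from assms obtain K L where *: "f \<in> borel_measurable M" "g \<in> borel_measurable M"
    "AE x in M. norm (f x) \<le> K" "AE x in M. norm (g x) \<le> L" by (auto simp: Linf_fun_def)
  show ?thesis
    by (rule Linf_funI[of _ _ "K + L"], use * in measurable)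
      (use *(3,4) in eventually_elim, rule norm_triangle_mono)
qed

lemma Linf_fun_mult: 
  assumes "f \<in> Linf_fun M" "g \<in> Linf_fun M" 
  shows "(\<lambda>x. f x * g x) \<in> Linf_fun M"
proof -
  from assms obtain K L where *: "f \<in> borel_measurable M" "g \<in> borel_measurable M"
    "AE x in M. norm (f x) \<le> K" "AE x in M. norm (g x) \<le> L" by (auto simp: Linf_fun_def)
  have "AE x in M. norm (f x * g x) \<le> \<bar>K\<bar> * \<bar>L\<bar>"
    using *(3,4) by eventually_elim (unfold norm_mult, intro mult_mono, auto)
  then show ?thesis
    by (intro Linf_funI, use * in measurable)
qed

lemma Linf_fun_cnj: "f \<in> Linf_fun M \<Longrightarrow> (\<lambda>x. cnj (f x)) \<in> Linf_fun M"
  by (auto simp: Linf_fun_def intro: borel_measurable_continuous_onI measurable_compose[OF _ borel_measurable_continuous_onI[OF continuous_on_cnj[OF continuous_on_id]]])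

lemma Linf_fun_sum:
  "(\<And>i. i \<in> I \<Longrightarrow> f i \<in> Linf_fun M) \<Longrightarrow> (\<lambda>x. \<Sum>i\<in>I. f i x) \<in> Linf_fun M"
  by (induction I rule: infinite_finite_induct) (auto intro: Linf_fun_const Linf_fun_add)

lemma pointwise_closed_Linf: "pointwise_closed (Linf_fun M) complex_algebra"
  by (simp add: pointwise_closed_def complex_algebra_def Linf_fun_const Linf_fun_add Linf_fun_mult
      Linf_fun_cnj)

lemma mat_adjoint_carrier [simp]: "A \<in> carrier_mat n m \<Longrightarrow> mat_adjoint A \<in> carrier_mat m n"
  by (auto simp: mat_adjoint_def mat_of_rows_def)

lemma mat_adjoint_index [simp]:
  "i < m \<Longrightarrow> j < n \<Longrightarrow> A \<in> carrier_mat n m \<Longrightarrow> mat_adjoint A $$ (i, j) = conjugate (A $$ (j, i))"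
  by (auto simp: mat_adjoint_def mat_of_rows_def)

lemma pointwise_closed_Linf_mat:
  fixes M :: "'x measure" shows "pointwise_closed (Linf_mat_fun M n) (mat_algebra n)"
proof -
  let ?S = "Linf_mat_fun M n"
  have mult: "(\<lambda>x. F x * G x) \<in> ?S" if "F \<in> ?S" "G \<in> ?S" for F G
  proof -
    have "(\<lambda>x. (F x * G x) $$ (i, j)) \<in> Linf_fun M" if ij: "i < n" "j < n" for i j
    proof -
      have "(\<lambda>x. \<Sum>k\<in>{0..<n}. F x $$ (i, k) * G x $$ (k, j)) \<in> Linf_fun M"
        using \<open>F \<in> ?S\<close> \<open>G \<in> ?S\<close> ij
        by (intro Linf_fun_sum Linf_fun_mult) (auto simp: Linf_mat_fun_def)
      moreover have "(F x * G x) $$ (i, j) = (\<Sum>k\<in>{0..<n}. F x $$ (i, k) * G x $$ (k, j))"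
        if "x \<in> space M" for x
      proof -
        have "F x \<in> carrier_mat n n" "G x \<in> carrier_mat n n"
          using \<open>F \<in> ?S\<close> \<open>G \<in> ?S\<close> that by (auto simp: Linf_mat_fun_def)
        then show ?thesis using ij by (auto simp: scalar_prod_def intro!: sum.cong)
      qed
      ultimately show ?thesis by (subst Linf_fun_cong) auto
    qed
    then show ?thesis using that by (auto simp: Linf_mat_fun_def)
  qed
  have add: "(\<lambda>x. F x + G x) \<in> ?S" if "F \<in> ?S" "G \<in> ?S" for F G
  proof -
    have "(\<lambda>x. (F x + G x) $$ (i, j)) \<in> Linf_fun M" if ij: "i < n" "j < n" for i j
    proof -
      have "(\<lambda>x. F x $$ (i, j) + G x $$ (i, j)) \<in> Linf_fun M"
        using \<open>F \<in> ?S\<close> \<open>G \<in> ?S\<close> ij by (intro Linf_fun_add) (auto simp: Linf_mat_fun_def)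
      moreover have "(F x + G x) $$ (i, j) = F x $$ (i, j) + G x $$ (i, j)"
        if "x \<in> space M" for x
      proof -
        have "F x \<in> carrier_mat n n" "G x \<in> carrier_mat n n"
          using \<open>F \<in> ?S\<close> \<open>G \<in> ?S\<close> that by (auto simp: Linf_mat_fun_def)
        then show ?thesis using ij by auto
      qed
      ultimately show ?thesis by (subst Linf_fun_cong) auto
    qed
    then show ?thesis using that by (auto simp: Linf_mat_fun_def)
  qed
  have smult: "(\<lambda>x. c \<cdot>\<^sub>m F x) \<in> ?S" if "F \<in> ?S" for F c
  proof -
    have "(\<lambda>x. (c \<cdot>\<^sub>m F x) $$ (i, j)) \<in> Linf_fun M" if ij: "i < n" "j < n" for i j
    proof -
      have "(\<lambda>x. c * F x $$ (i, j)) \<in> Linf_fun M"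
        using \<open>F \<in> ?S\<close> ij by (intro Linf_fun_mult Linf_fun_const) (auto simp: Linf_mat_fun_def)
      moreover have "(c \<cdot>\<^sub>m F x) $$ (i, j) = c * F x $$ (i, j)" if "x \<in> space M" for x
      proof -
        have "F x \<in> carrier_mat n n" using \<open>F \<in> ?S\<close> that by (auto simp: Linf_mat_fun_def)
        then show ?thesis using ij by auto
      qed
      ultimately show ?thesis by (subst Linf_fun_cong) auto
    qed
    then show ?thesis using that by (auto simp: Linf_mat_fun_def)
  qed
  have adj: "(\<lambda>x. mat_adjoint (F x)) \<in> ?S" if "F \<in> ?S" for F
  proof -
    have "(\<lambda>x. mat_adjoint (F x) $$ (i, j)) \<in> Linf_fun M" if ij: "i < n" "j < n" for i j
    proof -
      have "(\<lambda>x. cnj (F x $$ (j, i))) \<in> Linf_fun M"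
        using \<open>F \<in> ?S\<close> ij by (intro Linf_fun_cnj) (auto simp: Linf_mat_fun_def)
      moreover have "mat_adjoint (F x) $$ (i, j) = cnj (F x $$ (j, i))" if "x \<in> space M" for x
      proof -
        have "F x \<in> carrier_mat n n" using \<open>F \<in> ?S\<close> that by (auto simp: Linf_mat_fun_def)
        then show ?thesis using ij by auto
      qed
      ultimately show ?thesis by (subst Linf_fun_cong) auto
    qed
    then show ?thesis using that by (auto simp: Linf_mat_fun_def)
  qed
  have const: "(\<lambda>_. A) \<in> ?S" if "A \<in> carrier_mat n n" for A
    using that by (auto simp: Linf_mat_fun_def Linf_fun_const)
  show ?thesis
    by (simp add: pointwise_closed_def mat_algebra_def mult add smult adj const)
qed

lemma Linf_carrier: "carrier (Linf M) = Linf_class M ` Linf_fun M"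
  by (simp add: Linf_def ae_algebra_def)

lemma Linf_mat_carrier: "carrier (Linf_mat M n) = Linf_mat_class M n ` Linf_mat_fun M n"
  by (simp add: Linf_mat_def ae_algebra_def)

lemma Linf_mat_fun_entry:
  "F \<in> Linf_mat_fun M n \<Longrightarrow> i < n \<Longrightarrow> j < n \<Longrightarrow> (\<lambda>x. F x $$ (i, j)) \<in> Linf_fun M"
  by (simp add: Linf_mat_fun_def)

lemma Linf_mat_fun_carrier: "F \<in> Linf_mat_fun M n \<Longrightarrow> x \<in> space M \<Longrightarrow> F x \<in> carrier_mat n n"
  by (simp add: Linf_mat_fun_def)

lemma Linf_mat_AE_iff:
  assumes "F \<in> Linf_mat_fun M n" "G \<in> Linf_mat_fun M n"
  shows "(AE x in M. F x = G x) \<longleftrightarrow> (\<forall>i<n. \<forall>j<n. AE x in M. F x $$ (i, j) = G x $$ (i, j))"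
proof
  assume "\<forall>i<n. \<forall>j<n. AE x in M. F x $$ (i, j) = G x $$ (i, j)"
  then have "AE x in M. \<forall>i\<in>{..<n}. \<forall>j\<in>{..<n}. F x $$ (i, j) = G x $$ (i, j)"
    by (intro AE_finite_allI) auto
  then show "AE x in M. F x = G x"
    using AE_space
  proof eventually_elim
    case (elim x)
    then show ?case
      using Linf_mat_fun_carrier[OF assms(1), of x] Linf_mat_fun_carrier[OF assms(2), of x]
      by (intro eq_matI) auto
  qed
qed (auto elim: eventually_mono)

lemma entry_class:
  assumes "F \<in> Linf_mat_fun M n"
  shows "entry M (Linf_mat_class M n F) i j = Linf_class M (\<lambda>x. F x $$ (i, j))"
  unfolding entry_def
  by (rule UN_ae_class[OF assms], rule ae_class_cong) (auto elim: eventually_mono)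

lemma tensor_class:
  assumes "f \<in> Linf_fun M"
  shows "tensor M n (Linf_class M f) A = Linf_mat_class M n (\<lambda>x. f x \<cdot>\<^sub>m A)"
  unfolding tensor_def
  by (rule UN_ae_class[OF assms], rule ae_class_cong) (auto elim: eventually_mono)

lemma Linf_mat_fun_tensor:
  "f \<in> Linf_fun M \<Longrightarrow> A \<in> carrier_mat n n \<Longrightarrow> (\<lambda>x. f x \<cdot>\<^sub>m A) \<in> Linf_mat_fun M n"
  by (auto simp: Linf_mat_fun_def intro!: Linf_fun_mult Linf_fun_const)

text \<open>Elements of \<open>Linf_mat M n\<close> correspond to arbitrary \<open>n \<times> n\<close> matrices with entries in \<open>Linf M\<close>, and
  the \<open>(i, j)\<close> entry of an elementary tensor \<open>a \<otimes> A\<close> is \<open>A\<^sub>i\<^sub>j a\<close>.\<close>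

lemma entry_bij:
  "bij_betw (\<lambda>T. \<lambda>(i, j)\<in>{..<n} \<times> {..<n}. entry M T i j) (carrier (Linf_mat M n))
     ({..<n} \<times> {..<n} \<rightarrow>\<^sub>E carrier (Linf M))" (is "bij_betw ?e _ _")
proof (rule bij_betw_imageI)
  show "inj_on ?e (carrier (Linf_mat M n))"
  proof (rule inj_onI)
    fix S T assume S: "S \<in> carrier (Linf_mat M n)" and T: "T \<in> carrier (Linf_mat M n)"
      and eq: "?e S = ?e T"
    obtain F where F: "F \<in> Linf_mat_fun M n" "S = Linf_mat_class M n F"
      using S by (auto simp: Linf_mat_carrier)
    obtain G where G: "G \<in> Linf_mat_fun M n" "T = Linf_mat_class M n G"
      using T by (auto simp: Linf_mat_carrier)
    have "AE x in M. F x $$ (i, j) = G x $$ (i, j)" if "i < n" "j < n" for i j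
    proof -
      have "entry M S i j = entry M T i j" using fun_cong[OF eq, of "(i, j)"] that by simp
      then show ?thesis
        unfolding F(2) G(2) entry_class[OF F(1)] entry_class[OF G(1)]
        using Linf_mat_fun_entry[OF F(1) that] Linf_mat_fun_entry[OF G(1) that]
        by (simp add: ae_class_eq_iff)
    qed
    then show "S = T"
      unfolding F(2) G(2) using Linf_mat_AE_iff[OF F(1) G(1)] by (intro ae_class_cong) auto
  qed
  show "?e ` carrier (Linf_mat M n) = {..<n} \<times> {..<n} \<rightarrow>\<^sub>E carrier (Linf M)"
  proof (intro equalityI subsetI)
    fix E assume "E \<in> ?e ` carrier (Linf_mat M n)"
    then obtain F where F: "F \<in> Linf_mat_fun M n" and E: "E = ?e (Linf_mat_class M n F)"
      by (auto simp: Linf_mat_carrier)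
    show "E \<in> {..<n} \<times> {..<n} \<rightarrow>\<^sub>E carrier (Linf M)"
      unfolding E by (rule restrict_PiE_iff[THEN iffD2])
        (auto simp: Linf_carrier entry_class[OF F] Linf_mat_fun_entry[OF F])
  next
    fix E assume E: "E \<in> {..<n} \<times> {..<n} \<rightarrow>\<^sub>E carrier (Linf M)"
    then have "\<forall>p\<in>{..<n} \<times> {..<n}. \<exists>f. f \<in> Linf_fun M \<and> E p = Linf_class M f"
      unfolding Linf_carrier by (intro ballI) (drule (1) PiE_mem, blast)
    then obtain f where f: "\<And>p. p \<in> {..<n} \<times> {..<n} \<Longrightarrow> f p \<in> Linf_fun M \<and> E p = Linf_class M (f p)"
      by metis
    define F where "F = (\<lambda>x. mat n n (\<lambda>p. f p x))"
    have F: "F \<in> Linf_mat_fun M n"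
      using f by (auto simp: F_def Linf_mat_fun_def)
    have "?e (Linf_mat_class M n F) p = E p" for p
      using f E by (cases p) (auto simp: restrict_def entry_class[OF F], auto simp: F_def PiE_def extensional_def)
    then have "?e (Linf_mat_class M n F) = E" by blast
    then show "E \<in> ?e ` carrier (Linf_mat M n)"
      using F unfolding Linf_mat_carrier by blast
  qed
qed

lemma entry_tensor:
  assumes "a \<in> carrier (Linf M)" "A \<in> carrier_mat n n" "i < n" "j < n"
  shows "entry M (tensor M n a A) i j = (A $$ (i, j)) \<odot>\<^bsub>Linf M\<^esub> a"
proof -
  obtain f where f: "f \<in> Linf_fun M" "a = Linf_class M f"
    using assms(1) by (auto simp: Linf_carrier)
  have "entry M (tensor M n a A) i j = Linf_class M (\<lambda>x. (f x \<cdot>\<^sub>m A) $$ (i, j))"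
    unfolding f(2) tensor_class[OF f(1)] entry_class[OF Linf_mat_fun_tensor[OF f(1) assms(2)]] ..
  also have "\<dots> = Linf_class M (\<lambda>x. A $$ (i, j) * f x)"
    using assms by (simp add: mult.commute)
  finally show ?thesis
    by (simp add: f(2) Linf_def ae_algebra_class(3)[OF f(1) f(1)] complex_algebra_def)
qed

section \<open>Well-definedness of the automorphisms\<close>

lemma inv_shift: "inv_into UNIV shift = (\<lambda>x i. x (i + 1))"
  by (rule inv_equality) (auto simp: shift_def)

lemma bij_shift: "bij shift"
  by (rule o_bij[of "\<lambda>x i. x (i + 1)"]) (auto simp: shift_def fun_eq_iff)

lemma space_bernoulli: "space (bernoulli \<mu>1) = (UNIV \<rightarrow> space \<mu>1)"
  by (simp add: bernoulli_def space_PiM PiE_def)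

lemma measurable_translate: "(\<lambda>x i. x (i + k)) \<in> bernoulli \<mu>1 \<rightarrow>\<^sub>M bernoulli \<mu>1" for k :: int
  unfolding bernoulli_def by (rule measurable_PiM_single') (auto simp: space_PiM PiE_def)

lemma distr_translate:
  fixes k :: int
  assumes "prob_space \<mu>1"
  shows "distr (bernoulli \<mu>1) (bernoulli \<mu>1) (\<lambda>x i. x (i + k)) = bernoulli \<mu>1"
  using distr_PiM_reindex[of UNIV "\<lambda>_. \<mu>1" "\<lambda>i. i + k" UNIV] assms
  by (simp add: bernoulli_def restrict_def)

lemma AE_translate:
  fixes k :: int
  assumes "prob_space \<mu>1" "AE x in bernoulli \<mu>1. P x"
  shows "AE x in bernoulli \<mu>1. P (\<lambda>i. x (i + k))"
  by (rule AE_distrD[OF measurable_translate]) (unfold distr_translate[OF assms(1)], rule assms(2))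

lemma Linf_fun_translate:
  fixes k :: int
  assumes "prob_space \<mu>1" "f \<in> Linf_fun (bernoulli \<mu>1)"
  shows "(\<lambda>x. f (\<lambda>i. x (i + k))) \<in> Linf_fun (bernoulli \<mu>1)"
proof -
  from assms(2) obtain K where *: "f \<in> borel_measurable (bernoulli \<mu>1)"
    "AE x in bernoulli \<mu>1. norm (f x) \<le> K" by (auto simp: Linf_fun_def)
  show ?thesis
    using measurable_compose[OF measurable_translate *(1)] AE_translate[OF assms(1) *(2)]
    by (rule Linf_funI)
qed

lemma Linf_mat_fun_translate:
  fixes k :: int
  assumes "prob_space \<mu>1" "F \<in> Linf_mat_fun (bernoulli \<mu>1) n"
  shows "(\<lambda>x. F (\<lambda>i. x (i + k))) \<in> Linf_mat_fun (bernoulli \<mu>1) n"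
  unfolding Linf_mat_fun_def
proof (intro CollectI conjI ballI allI impI)
  fix x assume "x \<in> space (bernoulli \<mu>1)"
  from measurable_space[OF measurable_translate this]
  show "F (\<lambda>i. x (i + k)) \<in> carrier_mat n n" by (rule Linf_mat_fun_carrier[OF assms(2)])
next
  fix i j assume "i < n" "j < n"
  from Linf_fun_translate[OF assms(1) Linf_mat_fun_entry[OF assms(2) this]]
  show "(\<lambda>x. F (\<lambda>i. x (i + k)) $$ (i, j)) \<in> Linf_fun (bernoulli \<mu>1)" .
qed

lemma alpha_class:
  assumes "prob_space \<mu>1" "f \<in> Linf_fun (bernoulli \<mu>1)"
  shows "alpha \<mu>1 (Linf_class (bernoulli \<mu>1) f) = Linf_class (bernoulli \<mu>1) (\<lambda>x. f (\<lambda>i. x (i + 1)))"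
  unfolding alpha_def inv_shift comp_def
proof (rule UN_ae_class[OF assms(2)], rule ae_class_cong)
  fix g assume "AE x in bernoulli \<mu>1. f x = g x"
  from AE_translate[OF assms(1) this, of 1]
  show "AE x in bernoulli \<mu>1. g (\<lambda>i. x (i + 1)) = f (\<lambda>i. x (i + 1))"
    by (auto elim: eventually_mono)
qed

lemma star_automorphism_alpha:
  assumes "prob_space \<mu>1"
  shows "star_automorphism (Linf (bernoulli \<mu>1)) (alpha \<mu>1)"
  unfolding Linf_def
proof (rule star_automorphism_ae_algebraI[where \<Phi> = "\<lambda>f x. f (\<lambda>i. x (i + 1))"
      and \<Psi> = "\<lambda>f x. f (\<lambda>i. x (i + -1))"])
  fix f g :: "(int \<Rightarrow> 'a) \<Rightarrow> complex"
  assume "AE x in bernoulli \<mu>1. f (\<lambda>i. x (i + 1)) = g (\<lambda>i. x (i + 1))"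
  from AE_translate[OF assms this, of "-1"] show "AE x in bernoulli \<mu>1. f x = g x"
    by simp
qed (use assms pointwise_closed_Linf Linf_fun_translate[OF assms, of _ 1]
    Linf_fun_translate[OF assms, of _ "-1"] in \<open>auto simp: alpha_class\<close>)

lemma tensor_id_alpha_class:
  assumes "prob_space \<mu>1" "F \<in> Linf_mat_fun (bernoulli \<mu>1) n"
  shows "tensor_id (bernoulli \<mu>1) n (alpha \<mu>1) (Linf_mat_class (bernoulli \<mu>1) n F) =
    Linf_mat_class (bernoulli \<mu>1) n (\<lambda>x. F (\<lambda>i. x (i + 1)))"
proof -
  let ?M = "bernoulli \<mu>1" and ?G = "\<lambda>x. F (\<lambda>i. x (i + 1))"
  have G: "?G \<in> Linf_mat_fun ?M n" by (rule Linf_mat_fun_translate[OF assms])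
  have e: "alpha \<mu>1 (entry ?M (Linf_mat_class ?M n F) i j) = Linf_class ?M (\<lambda>x. ?G x $$ (i, j))"
    if "i < n" "j < n" for i j
    by (simp add: entry_class[OF assms(2)] alpha_class[OF assms(1) Linf_mat_fun_entry[OF assms(2) that]])
  show ?thesis
    unfolding tensor_id_def ae_class_def[of _ "Linf_mat_fun ?M n" "?G"]
    by (intro Collect_cong conj_cong refl)
      (auto simp: e Linf_mat_AE_iff[OF G] Linf_mat_fun_entry ae_class_def[of _ "Linf_fun ?M"])
qed

lemma tensor_id_alpha_tensor:
  assumes "prob_space \<mu>1" "a \<in> carrier (Linf (bernoulli \<mu>1))" "A \<in> carrier_mat n n"
  shows "tensor_id (bernoulli \<mu>1) n (alpha \<mu>1) (tensor (bernoulli \<mu>1) n a A) =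
    tensor (bernoulli \<mu>1) n (alpha \<mu>1 a) A"
  using assms(2)
  by (auto simp: Linf_carrier tensor_class alpha_class tensor_id_alpha_class assms Linf_mat_fun_tensor
      Linf_fun_translate)

lemma clock_root_power: "n > 0 \<Longrightarrow> clock_root n ^ n = 1"
  by (simp add: clock_root_def exp_of_nat_mult[symmetric])

lemma cnj_clock_root: "cnj (clock_root n) * clock_root n = 1"
  by (simp add: clock_root_def exp_cnj exp_add[symmetric])

lemma clock_mat_carrier [simp]: "clock_mat n \<in> carrier_mat n n"
  and shift_mat_carrier [simp]: "shift_mat n \<in> carrier_mat n n"
  by (simp_all add: clock_mat_def shift_mat_def)

lemma clock_shift_dim [simp]:
  "dim_row (clock_mat n) = n" "dim_col (clock_mat n) = n"
  "dim_row (shift_mat n) = n" "dim_col (shift_mat n) = n"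
  by (simp_all add: clock_mat_def shift_mat_def)

lemma mat_adjoint_dim [simp]:
  "dim_row (mat_adjoint A) = dim_col A" "dim_col (mat_adjoint A) = dim_row A"
  by (simp_all add: mat_adjoint_def)

lemma mult_mat_index:
  assumes "A \<in> carrier_mat n n" "B \<in> carrier_mat n n" "i < n" "j < n"
  shows "(A * B) $$ (i, j) = (\<Sum>k\<in>{0..<n}. A $$ (i, k) * B $$ (k, j))"
  using assms by (auto simp: scalar_prod_def intro!: sum.cong)

lemma clock_mat_unitary: "mat_adjoint (clock_mat n) * clock_mat n = 1\<^sub>m n" (is ?L)
    "clock_mat n * mat_adjoint (clock_mat n) = 1\<^sub>m n"
proof -
  show ?L
  proof (rule eq_matI)
    fix i j assume "i < dim_row (1\<^sub>m n :: complex mat)" "j < dim_col (1\<^sub>m n :: complex mat)"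
    then have ij: "i < n" "j < n" by auto
    have "(mat_adjoint (clock_mat n) * clock_mat n) $$ (i, j) =
        (\<Sum>k\<in>{0..<n}. mat_adjoint (clock_mat n) $$ (i, k) * clock_mat n $$ (k, j))"
      by (intro mult_mat_index mat_adjoint_carrier clock_mat_carrier ij)
    also have "\<dots> = (\<Sum>k\<in>{0..<n}. if k = j then cnj (if k = i then clock_root n ^ k else 0) * clock_root n ^ j else 0)"
      using ij by (intro sum.cong refl)
        (simp add: mat_adjoint_index[OF _ _ clock_mat_carrier], simp add: clock_mat_def)
    also have "\<dots> = (if i = j then (cnj (clock_root n) * clock_root n) ^ i else 0)"
      using ij by (subst sum.delta) (auto simp: power_mult_distrib)
    finally show "(mat_adjoint (clock_mat n) * clock_mat n) $$ (i, j) = 1\<^sub>m n $$ (i, j)"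
      using ij by (simp add: cnj_clock_root)
  qed simp_all
  then show "clock_mat n * mat_adjoint (clock_mat n) = 1\<^sub>m n"
    by (rule mat_mult_left_right_inverse[rotated 2]) simp_all
qed

lemma shift_conj_index:
  assumes "D = mat n n (\<lambda>(i, j). if i = j then d i else (0 :: complex))" "i < n" "j < n"
  shows "(shift_mat n * D * mat_adjoint (shift_mat n)) $$ (i, j) =
    (if i = j then d ((i + 1) mod n) else 0)"
proof -
  have D: "D \<in> carrier_mat n n" by (simp add: assms(1))
  have 1: "(shift_mat n * D) $$ (i, k) = (if k = (i + 1) mod n then d k else 0)" if "k < n" for k
  proof -
    have "(shift_mat n * D) $$ (i, k) = (\<Sum>l\<in>{0..<n}. shift_mat n $$ (i, l) * D $$ (l, k))"
      by (intro mult_mat_index shift_mat_carrier D assms(2) that)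
    also have "\<dots> = (\<Sum>l\<in>{0..<n}. if l = k then (if k = (i + 1) mod n then d k else 0) else 0)"
      using assms(2) that by (intro sum.cong refl) (simp add: assms(1) shift_mat_def)
    finally show ?thesis using that by (simp add: sum.delta)
  qed
  have inj: "(i + 1) mod n = (j + 1) mod n \<longleftrightarrow> i = j"
    using assms(2,3) by (auto simp: mod_Suc split: if_splits)
  have "(shift_mat n * D * mat_adjoint (shift_mat n)) $$ (i, j) =
      (\<Sum>k\<in>{0..<n}. (shift_mat n * D) $$ (i, k) * mat_adjoint (shift_mat n) $$ (k, j))"
    by (intro mult_mat_index mult_carrier_mat[of _ n n] mat_adjoint_carrier shift_mat_carrier D assms(2,3))
  also have "\<dots> = (\<Sum>k\<in>{0..<n}. if k = (i + 1) mod n then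
      (if (i + 1) mod n = (j + 1) mod n then d ((i + 1) mod n) else 0) else 0)"
    using assms(2,3) by (intro sum.cong refl)
      (simp add: 1 mat_adjoint_index[OF _ _ shift_mat_carrier] del: index_mult_mat(1),
        simp add: shift_mat_def)
  also have "\<dots> = (if i = j then d ((i + 1) mod n) else 0)"
    using assms(2) unfolding inj by (subst sum.delta) auto
  finally show ?thesis .
qed

lemma shift_mat_unitary: "mat_adjoint (shift_mat n) * shift_mat n = 1\<^sub>m n"
    "shift_mat n * mat_adjoint (shift_mat n) = 1\<^sub>m n" (is ?R)
proof -
  have "shift_mat n * 1\<^sub>m n * mat_adjoint (shift_mat n) = 1\<^sub>m n"
    by (rule eq_matI, subst shift_conj_index[where d = "\<lambda>_. 1", OF meta_eq_to_obj_eq[OF one_mat_def]]) simp_all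
  then show ?R using right_mult_one_mat[OF shift_mat_carrier[of n]] by simp
  then show "mat_adjoint (shift_mat n) * shift_mat n = 1\<^sub>m n"
    by (rule mat_mult_left_right_inverse[rotated 2]) simp_all
qed

lemma shift_mat_clock_mat:
  "shift_mat n * clock_mat n * mat_adjoint (shift_mat n) = clock_root n \<cdot>\<^sub>m clock_mat n"
proof (rule eq_matI)
  fix i j assume "i < dim_row (clock_root n \<cdot>\<^sub>m clock_mat n)" "j < dim_col (clock_root n \<cdot>\<^sub>m clock_mat n)"
  then have ij: "i < n" "j < n" by (auto simp: clock_mat_def)
  have "clock_root n ^ (Suc i mod n) = clock_root n * clock_root n ^ i"
    using ij clock_root_power[of n] by (auto simp: mod_Suc simp flip: power_Suc)
  then show "(shift_mat n * clock_mat n * mat_adjoint (shift_mat n)) $$ (i, j) =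
      (clock_root n \<cdot>\<^sub>m clock_mat n) $$ (i, j)"
    using ij by (subst shift_conj_index[OF clock_mat_def]) (auto simp: clock_mat_def)
qed simp_all

lemma cocycle_unitary_class:
  fixes M :: "'x measure" and n :: nat
  assumes "C \<in> sets M" "D = space M - C"
  defines "w \<equiv> \<lambda>x. if x \<in> C then mat_adjoint (clock_mat n) else mat_adjoint (shift_mat n)"
  shows "cocycle_unitary M n C D = Linf_mat_class M n w" and "w \<in> Linf_mat_fun M n"
proof -
  have D: "D \<in> sets M" using assms by auto
  have ind: "indicator S \<in> Linf_fun M" if "S \<in> sets M" for S
    by (rule Linf_funI[of _ _ 1], use that in measurable) (auto simp: indicator_def)
  note CD = ind[OF assms(1)] ind[OF D]
  note U = mat_adjoint_carrier[OF clock_mat_carrier[of n]] mat_adjoint_carrier[OF shift_mat_carrier[of n]]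
  note T = Linf_mat_fun_tensor[OF CD(1) U(1)] Linf_mat_fun_tensor[OF CD(2) U(2)]
  let ?w = "\<lambda>x. indicator C x \<cdot>\<^sub>m mat_adjoint (clock_mat n) + indicator D x \<cdot>\<^sub>m mat_adjoint (shift_mat n)"
  have w: "?w x = w x" if "x \<in> space M" for x
  proof (cases "x \<in> C")
    case True
    then show ?thesis by (intro eq_matI) (simp_all add: w_def assms(2))
  next
    case False
    then show ?thesis using that by (intro eq_matI) (simp_all add: w_def assms(2))
  qed
  have "cocycle_unitary M n C D = Linf_mat_class M n ?w"
    unfolding cocycle_unitary_def tensor_class[OF CD(1)] tensor_class[OF CD(2)]
    by (simp add: Linf_mat_def ae_algebra_class[OF T] mat_algebra_def)
  also have "\<dots> = Linf_mat_class M n w"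
    by (rule ae_class_cong, rule AE_I2, rule w)
  finally show "cocycle_unitary M n C D = Linf_mat_class M n w" .
  have "?w \<in> Linf_mat_fun M n"
    using pointwise_closed_Linf_mat[of M n] T by (simp add: pointwise_closed_def mat_algebra_def)
  note w' = Linf_mat_fun_entry[OF this]
  show "w \<in> Linf_mat_fun M n"
    unfolding Linf_mat_fun_def
  proof (intro CollectI conjI ballI allI impI)
    fix x show "w x \<in> carrier_mat n n" using U by (simp add: w_def)
  next
    fix i j assume ij: "i < n" "j < n"
    have "(\<lambda>x. ?w x $$ (i, j)) \<in> Linf_fun M \<longleftrightarrow> (\<lambda>x. w x $$ (i, j)) \<in> Linf_fun M"
      by (rule Linf_fun_cong, subst w) simp_all
    with w'[OF ij] show "(\<lambda>x. w x $$ (i, j)) \<in> Linf_fun M" by blast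
  qed
qed

lemma mat_adjoint_mult:
  fixes A B :: "complex mat"
  assumes "A \<in> carrier_mat n n" "B \<in> carrier_mat n n"
  shows "mat_adjoint (A * B) = mat_adjoint B * mat_adjoint A"
proof (rule eq_matI)
  note A' = mat_adjoint_carrier[OF assms(1)] and B' = mat_adjoint_carrier[OF assms(2)]
  fix i j assume "i < dim_row (mat_adjoint B * mat_adjoint A)" "j < dim_col (mat_adjoint B * mat_adjoint A)"
  then have ij: "i < n" "j < n" using A' B' by auto
  have "mat_adjoint (A * B) $$ (i, j) = cnj ((A * B) $$ (j, i))"
    using mat_adjoint_index[OF ij mult_carrier_mat[OF assms]] by simp
  also have "\<dots> = (\<Sum>k\<in>{0..<n}. cnj (A $$ (j, k)) * cnj (B $$ (k, i)))"
    by (simp add: mult_mat_index[OF assms ij(2,1)])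
  also have "\<dots> = (mat_adjoint B * mat_adjoint A) $$ (i, j)"
    using ij by (simp add: mult_mat_index[OF B' A' ij] mat_adjoint_index[OF _ _ assms(1)]
        mat_adjoint_index[OF _ _ assms(2)] mult.commute)
  finally show "mat_adjoint (A * B) $$ (i, j) = (mat_adjoint B * mat_adjoint A) $$ (i, j)" .
qed (use assms in simp_all)

lemma mat_adjoint_adjoint:
  fixes A :: "complex mat"
  assumes "A \<in> carrier_mat n m"
  shows "mat_adjoint (mat_adjoint A) = A"
proof (rule eq_matI)
  note A' = mat_adjoint_carrier[OF assms] and A'' = mat_adjoint_carrier[OF mat_adjoint_carrier[OF assms]]
  fix i j assume "i < dim_row A" "j < dim_col A"
  then show "mat_adjoint (mat_adjoint A) $$ (i, j) = A $$ (i, j)"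
    using assms by (simp add: mat_adjoint_index[OF _ _ A'] mat_adjoint_index[OF _ _ assms])
qed simp_all

lemma unitary_conj:
  fixes A B W :: "complex mat"
  assumes W: "W \<in> carrier_mat n n" "mat_adjoint W * W = 1\<^sub>m n" "W * mat_adjoint W = 1\<^sub>m n"
    and A: "A \<in> carrier_mat n n" and B: "B \<in> carrier_mat n n"
  shows "W * (A + B) * mat_adjoint W = W * A * mat_adjoint W + W * B * mat_adjoint W"
    and "W * (A * B) * mat_adjoint W = (W * A * mat_adjoint W) * (W * B * mat_adjoint W)"
    and "W * mat_adjoint A * mat_adjoint W = mat_adjoint (W * A * mat_adjoint W)"
    and "W * (c \<cdot>\<^sub>m A) * mat_adjoint W = c \<cdot>\<^sub>m (W * A * mat_adjoint W)"
    and "mat_adjoint W * (W * A * mat_adjoint W) * W = A"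
    and "W * (mat_adjoint W * A * W) * mat_adjoint W = A"
proof -
  note V = mat_adjoint_carrier[OF W(1)] and A' = mat_adjoint_carrier[OF A]
  note assoc = assoc_mult_mat[of _ n n _ n _ n]
  have cancel: "mat_adjoint W * (W * Y) = Y" "W * (mat_adjoint W * Y) = Y"
    if "Y \<in> carrier_mat n n" for Y
    using that W V by (simp_all flip: assoc)
  show "W * (A + B) * mat_adjoint W = W * A * mat_adjoint W + W * B * mat_adjoint W"
    unfolding mult_add_distrib_mat[OF W(1) A B]
    by (rule add_mult_distrib_mat[OF mult_carrier_mat[OF W(1) A] mult_carrier_mat[OF W(1) B] V])
  show "W * (A * B) * mat_adjoint W = (W * A * mat_adjoint W) * (W * B * mat_adjoint W)"
    using W(1) V A B by (simp add: assoc cancel)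
  show "W * mat_adjoint A * mat_adjoint W = mat_adjoint (W * A * mat_adjoint W)"
    using W(1) V A A'
    by (simp add: mat_adjoint_mult[of _ n] mat_adjoint_adjoint[OF W(1)] assoc)
  show "W * (c \<cdot>\<^sub>m A) * mat_adjoint W = c \<cdot>\<^sub>m (W * A * mat_adjoint W)"
    unfolding mult_smult_distrib[OF W(1) A]
    by (rule mult_smult_assoc_mat[OF mult_carrier_mat[OF W(1) A] V])
  show "mat_adjoint W * (W * A * mat_adjoint W) * W = A"
    using W V A by (simp add: assoc cancel)
  show "W * (mat_adjoint W * A * W) * mat_adjoint W = A"
    using W V A by (simp add: assoc cancel)
qed

lemma star_automorphism_beta:
  fixes \<mu>1 :: "'a measure" and n :: nat
  assumes "prob_space \<mu>1" "C \<in> sets (bernoulli \<mu>1)" "D = space (bernoulli \<mu>1) - C"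
  shows "star_automorphism (Linf_mat (bernoulli \<mu>1) n) (beta \<mu>1 n C D)"
proof -
  define w where "w = (\<lambda>x. if x \<in> C then mat_adjoint (clock_mat n) else mat_adjoint (shift_mat n))"
  let ?M = "bernoulli \<mu>1" let ?S = "Linf_mat_fun ?M n"
  define \<Phi> where "\<Phi> = (\<lambda>F x. w x * F (\<lambda>i. x (i + 1)) * mat_adjoint (w x))"
  define \<Psi> where "\<Psi> = (\<lambda>F x. mat_adjoint (w (\<lambda>i. x (i + -1))) * F (\<lambda>i. x (i + -1)) * w (\<lambda>i. x (i + -1)))"
  have w_class: "cocycle_unitary ?M n C D = Linf_mat_class ?M n w" and w: "w \<in> ?S"
    using cocycle_unitary_class[OF assms(2,3), of n] by (simp_all add: w_def)
  have w_unitary: "w x \<in> carrier_mat n n" "mat_adjoint (w x) * w x = 1\<^sub>m n"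
      "w x * mat_adjoint (w x) = 1\<^sub>m n" for x
    using mat_adjoint_carrier[OF clock_mat_carrier[of n]] mat_adjoint_carrier[OF shift_mat_carrier[of n]]
    by (simp_all add: w_def mat_adjoint_adjoint[OF clock_mat_carrier]
        mat_adjoint_adjoint[OF shift_mat_carrier] clock_mat_unitary shift_mat_unitary)
  have mult: "(\<lambda>x. F x * G x) \<in> ?S" if "F \<in> ?S" "G \<in> ?S" for F G
    using pointwise_closed_Linf_mat[of ?M n] that by (auto simp: pointwise_closed_def mat_algebra_def)
  have adj: "(\<lambda>x. mat_adjoint (F x)) \<in> ?S" if "F \<in> ?S" for F
    using pointwise_closed_Linf_mat[of ?M n] that by (auto simp: pointwise_closed_def mat_algebra_def)
  note tr = Linf_mat_fun_translate[OF assms(1)]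
  have tr_space: "(\<lambda>i. x (i + k)) \<in> space ?M" if "x \<in> space ?M" for x and k :: int
    using measurable_space[OF measurable_translate that] .
  have \<Phi>_in: "\<Phi> F \<in> ?S" if "F \<in> ?S" for F
    unfolding \<Phi>_def by (intro mult adj tr w that)
  have \<Psi>_in: "\<Psi> F \<in> ?S" if "F \<in> ?S" for F
    unfolding \<Psi>_def by (intro mult adj tr w that)
  note conj = unitary_conj[OF w_unitary]
  have car: "F (\<lambda>i. x (i + k)) \<in> carrier_mat n n" if "F \<in> ?S" "x \<in> space ?M" for F x and k :: int
    using Linf_mat_fun_carrier[OF that(1) tr_space[OF that(2)]] .
  show ?thesis
    unfolding Linf_mat_def
  proof (rule star_automorphism_ae_algebraI[where \<Phi> = \<Phi> and \<Psi> = \<Psi>])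
    fix F assume F: "F \<in> ?S"
    show "beta \<mu>1 n C D (Linf_mat_class ?M n F) = Linf_mat_class ?M n (\<Phi> F)"
      unfolding beta_def comp_def tensor_id_alpha_class[OF assms(1) F] Ad_def w_class \<Phi>_def
      by (simp add: Linf_mat_def ae_algebra_class[OF w w] ae_algebra_class[OF w tr[OF F]]
          ae_algebra_class[OF mult[OF w tr[OF F]] adj[OF w]] mat_algebra_def)
    show "AE x in ?M. \<Phi> (\<Psi> F) x = F x"
    proof (rule AE_I2)
      fix x assume "x \<in> space ?M"
      then show "\<Phi> (\<Psi> F) x = F x"
        using conj(6)[OF Linf_mat_fun_carrier[OF F] Linf_mat_fun_carrier[OF F]]
        by (simp add: \<Phi>_def \<Psi>_def)
    qed
    show "AE x in ?M. \<Phi> (\<lambda>x. star (mat_algebra n) (F x)) x = star (mat_algebra n) (\<Phi> F x)"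
      by (rule AE_I2) (simp add: \<Phi>_def mat_algebra_def conj(3)[OF car[OF F] car[OF F]])
    show "AE x in ?M. \<Phi> (\<lambda>x. c \<odot>\<^bsub>mat_algebra n\<^esub> F x) x = c \<odot>\<^bsub>mat_algebra n\<^esub> \<Phi> F x" for c
      by (rule AE_I2) (simp add: \<Phi>_def mat_algebra_def conj(4)[OF car[OF F] car[OF F]])
    fix G assume G: "G \<in> ?S"
    show "AE x in ?M. \<Phi> (\<lambda>x. F x \<oplus>\<^bsub>mat_algebra n\<^esub> G x) x = \<Phi> F x \<oplus>\<^bsub>mat_algebra n\<^esub> \<Phi> G x"
      by (rule AE_I2) (simp add: \<Phi>_def mat_algebra_def conj(1)[OF car[OF F] car[OF G]])
    show "AE x in ?M. \<Phi> (\<lambda>x. F x \<otimes>\<^bsub>mat_algebra n\<^esub> G x) x = \<Phi> F x \<otimes>\<^bsub>mat_algebra n\<^esub> \<Phi> G x"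
      by (rule AE_I2) (simp add: \<Phi>_def mat_algebra_def conj(2)[OF car[OF F] car[OF G]])
    assume "AE x in ?M. \<Phi> F x = \<Phi> G x"
    then have "AE x in ?M. F (\<lambda>i. x (i + 1)) = G (\<lambda>i. x (i + 1))"
      using AE_space
    proof eventually_elim
      case (elim x)
      have "F (\<lambda>i. x (i + 1)) = mat_adjoint (w x) * \<Phi> F x * w x"
        using conj(5)[OF car[OF F elim(2)] car[OF F elim(2)]] by (simp add: \<Phi>_def)
      also have "\<dots> = G (\<lambda>i. x (i + 1))"
        unfolding elim(1) using conj(5)[OF car[OF G elim(2)] car[OF G elim(2)]] by (simp add: \<Phi>_def)
      finally show ?case .
    qed
    from AE_translate[OF assms(1) this, of "-1"] show "AE x in ?M. F x = G x" by simp
  next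
    show "AE x in ?M. \<Phi> (\<lambda>_. \<one>\<^bsub>mat_algebra n\<^esub>) x = \<one>\<^bsub>mat_algebra n\<^esub>"
      by (rule AE_I2)
        (simp add: \<Phi>_def mat_algebra_def right_mult_one_mat[OF w_unitary(1)] w_unitary(3))
  qed (auto intro: pointwise_closed_Linf_mat \<Phi>_in \<Psi>_in)
qed

end

theory Submission
  imports Defs
begin

text \<open>A fixed point of \<open>\<beta>\<close> is a bounded function \<open>F\<close> with \<open>F(x) = w(x) F(T x) w(x)\<^sup>*\<close>, where
  \<open>T = \<sigma>\<^sup>-\<^sup>1\<close> and the unitary \<open>w(x)\<close> depends on \<open>x\<^sub>0\<close> only; for \<open>\<alpha>\<close> take \<open>n = 1\<close> and \<open>w = 1\<close>. Iterating,
  \<open>F(x) = V\<^sub>k(x) F(T\<^sup>k x) V\<^sub>k(x)\<^sup>*\<close> with \<open>V\<^sub>k\<close> depending on \<open>x\<^sub>0, \<dots>, x\<^sub>k\<^sub>-\<^sub>1\<close>. Approximating \<open>F\<close> in \<open>L\<^sup>1\<close> by a function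
  of the coordinates in \<open>[-m, m]\<close> and taking \<open>k \<ge> m\<close> shows that \<open>F\<close> is a limit of functions of the coordinates
  \<open>\<ge> 0\<close>; running the same argument backwards, it is also a limit of functions of the coordinates \<open>< 0\<close>.
  The entries of \<open>F\<close> are thus independent of themselves, so \<open>F\<close> is constant, and the constant commutes
  with both \<open>u\<close> and \<open>v\<close>.\<close>

section \<open>Approximation by functions of finitely many coordinates\<close>

text \<open>\<open>g\<close> is required to be integrable because a Bochner integral that does not
  exist has the value 0, so the distance bound alone could hold for a non-integrable
  \<open>g\<close>.\<close>

definition L1_closure :: "'x measure \<Rightarrow> ('x \<Rightarrow> complex) set \<Rightarrow> ('x \<Rightarrow> complex) set" where
  "L1_closure M S = {f. integrable M f \<and>
     (\<forall>\<epsilon>>0. \<exists>g\<in>S. integrable M g \<and> (\<integral>x. norm (f x - g x) \<partial>M) < \<epsilon>)}"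

lemma L1_closure_integrable: "f \<in> L1_closure M S \<Longrightarrow> integrable M f"
  by (simp add: L1_closure_def)

lemma L1_closureE:
  assumes "f \<in> L1_closure M S" "\<epsilon> > 0"
  obtains g where "g \<in> S" "integrable M g" "(\<integral>x. norm (f x - g x) \<partial>M) < \<epsilon>"
  using assms by (auto simp: L1_closure_def)

lemma L1_closure_subset: "f \<in> S \<Longrightarrow> integrable M f \<Longrightarrow> f \<in> L1_closure M S"
  by (auto simp: L1_closure_def intro!: bexI[of _ f])

lemma L1_closure_cong:
  assumes "f \<in> L1_closure M S" "\<And>x. x \<in> space M \<Longrightarrow> f x = g x"
  shows "g \<in> L1_closure M S"
proof -
  have "(\<integral>x. norm (f x - h x) \<partial>M) = (\<integral>x. norm (g x - h x) \<partial>M)" for h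
    using assms(2) by (intro Bochner_Integration.integral_cong) auto
  moreover have "integrable M f \<longleftrightarrow> integrable M g"
    using assms(2) by (intro Bochner_Integration.integrable_cong) auto
  ultimately show ?thesis using assms(1) by (simp add: L1_closure_def)
qed

lemma L1_closure_add:
  assumes S: "\<And>f g. f \<in> S \<Longrightarrow> g \<in> S \<Longrightarrow> (\<lambda>x. f x + g x) \<in> S"
    and f: "f \<in> L1_closure M S" and g: "g \<in> L1_closure M S"
  shows "(\<lambda>x. f x + g x) \<in> L1_closure M S"
  unfolding L1_closure_def
proof (intro CollectI conjI allI impI)
  note [simp] = L1_closure_integrable[OF f] L1_closure_integrable[OF g]
  show "integrable M (\<lambda>x. f x + g x)" by simp
  fix \<epsilon> :: real assume "\<epsilon> > 0"
  then have "\<epsilon> / 2 > 0" by simp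
  from L1_closureE[OF f this] obtain f'
    where f': "f' \<in> S" "integrable M f'" "(\<integral>x. norm (f x - f' x) \<partial>M) < \<epsilon> / 2" .
  from L1_closureE[OF g \<open>\<epsilon> / 2 > 0\<close>] obtain g'
    where g': "g' \<in> S" "integrable M g'" "(\<integral>x. norm (g x - g' x) \<partial>M) < \<epsilon> / 2" .
  note [simp] = f'(2) g'(2)
  have "(\<integral>x. norm (f x + g x - (f' x + g' x)) \<partial>M) \<le> (\<integral>x. norm (f x - f' x) + norm (g x - g' x) \<partial>M)"
    by (rule integral_mono) (auto intro: norm_diff_triangle_ineq)
  also have "\<dots> < \<epsilon>" using f'(3) g'(3) by simp
  finally show "\<exists>h\<in>S. integrable M h \<and> (\<integral>x. norm (f x + g x - h x) \<partial>M) < \<epsilon>"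
    using S[OF f'(1) g'(1)] by (intro bexI[of _ "\<lambda>x. f' x + g' x"]) auto
qed

lemma L1_closure_cmult:
  assumes S: "\<And>f. f \<in> S \<Longrightarrow> (\<lambda>x. c * f x) \<in> S" and f: "f \<in> L1_closure M S"
  shows "(\<lambda>x. c * f x) \<in> L1_closure M S"
  unfolding L1_closure_def
proof (intro CollectI conjI allI impI)
  show "integrable M (\<lambda>x. c * f x)" using L1_closure_integrable[OF f] by simp
  fix \<epsilon> :: real assume "\<epsilon> > 0"
  \<comment> \<open>The added 1 keeps the divisor positive when \<open>c = 0\<close>.\<close>
  then have "\<epsilon> / (norm c + 1) > 0" by (simp add: add_nonneg_pos)
  from L1_closureE[OF f this] obtain g
    where g: "g \<in> S" "integrable M g" "(\<integral>x. norm (f x - g x) \<partial>M) < \<epsilon> / (norm c + 1)" .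
  have "(\<integral>x. norm (c * f x - c * g x) \<partial>M) = norm c * (\<integral>x. norm (f x - g x) \<partial>M)"
    by (simp add: norm_mult flip: right_diff_distrib)
  also have "\<dots> \<le> (norm c + 1) * (\<integral>x. norm (f x - g x) \<partial>M)"
    by (intro mult_right_mono) auto
  also have "\<dots> < \<epsilon>"
    using g(3) pos_less_divide_eq[of "norm c + 1" _ \<epsilon>] by (simp add: mult.commute add_nonneg_pos)
  finally show "\<exists>h\<in>S. integrable M h \<and> (\<integral>x. norm (c * f x - h x) \<partial>M) < \<epsilon>"
    using S[OF g(1)] g(2) by (intro bexI[of _ "\<lambda>x. c * g x"]) auto
qed

text \<open>Dominated convergence brings some \<open>s i\<close> within \<epsilon>/2 of
  \<open>f\<close>, and an element of \<open>S\<close> lies within \<epsilon>/2 of that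
  \<open>s i\<close>. This is the limit step of the inductions over measurable sets and over
  integrable functions below.\<close>

lemma L1_closure_LIMSEQ:
  assumes s: "\<And>i. s i \<in> L1_closure M S" and f: "integrable M f" and w: "integrable M w"
    and lim: "\<And>x. x \<in> space M \<Longrightarrow> (\<lambda>i. s i x) \<longlonglongrightarrow> f x"
    and bound: "\<And>i x. x \<in> space M \<Longrightarrow> norm (s i x) \<le> w x"
  shows "f \<in> L1_closure M S"
  unfolding L1_closure_def
proof (intro CollectI conjI allI impI f)
  note [simp] = f w L1_closure_integrable[OF s]
  note [measurable] = borel_measurable_integrable[OF f] borel_measurable_integrable[OF L1_closure_integrable[OF s]]
  fix \<epsilon> :: real assume "\<epsilon> > 0"
  then have \<epsilon>: "\<epsilon> / 2 > 0" by simp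
  have "(\<lambda>i. \<integral>x. norm (f x - s i x) \<partial>M) \<longlonglongrightarrow> (\<integral>x. 0 \<partial>M)"
  proof (rule integral_dominated_convergence[where w = "\<lambda>x. norm (f x) + w x"])
    show "AE x in M. (\<lambda>i. norm (f x - s i x)) \<longlonglongrightarrow> 0"
    proof (rule AE_I2)
      fix x assume "x \<in> space M"
      from tendsto_norm[OF tendsto_diff[OF tendsto_const lim[OF this], of "f x"]]
      show "(\<lambda>i. norm (f x - s i x)) \<longlonglongrightarrow> 0" by simp
    qed
    show "AE x in M. norm (norm (f x - s i x)) \<le> norm (f x) + w x" for i
    proof (rule AE_I2)
      fix x assume "x \<in> space M"
      from bound[OF this, of i] norm_triangle_ineq4[of "f x" "s i x"]
      show "norm (norm (f x - s i x)) \<le> norm (f x) + w x" by simp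
    qed
  qed auto
  then have "\<forall>\<^sub>F i in sequentially. (\<integral>x. norm (f x - s i x) \<partial>M) < \<epsilon> / 2"
    by (intro order_tendstoD(2)[OF _ \<epsilon>]) simp
  then obtain i where i: "(\<integral>x. norm (f x - s i x) \<partial>M) < \<epsilon> / 2"
    by (auto simp: eventually_sequentially)
  from L1_closureE[OF s \<epsilon>] obtain g
    where g: "g \<in> S" "integrable M g" "(\<integral>x. norm (s i x - g x) \<partial>M) < \<epsilon> / 2" .
  note [simp] = g(2)
  have "(\<integral>x. norm (f x - g x) \<partial>M) \<le> (\<integral>x. norm (f x - s i x) + norm (s i x - g x) \<partial>M)"
    by (rule integral_mono) (auto intro: norm_diff_triangle_le)
  also have "\<dots> < \<epsilon>" using i g(3) by simp
  finally show "\<exists>g\<in>S. integrable M g \<and> (\<integral>x. norm (f x - g x) \<partial>M) < \<epsilon>"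
    using g by blast
qed

section \<open>Bounded functions of the coordinates in a given set\<close>

text \<open>Dependence on \<open>J\<close> is a condition on pairs of points, which passes directly
  to sums, products and translates; measurability over the product indexed by \<open>J\<close> is
  recovered in \<open>local_functions_factor\<close>. Boundedness at every point keeps products in
  the set.\<close>

definition local_functions :: "'a measure \<Rightarrow> int set \<Rightarrow> ((int \<Rightarrow> 'a) \<Rightarrow> complex) set" where
  "local_functions \<mu>1 J = {g \<in> borel_measurable (bernoulli \<mu>1).
     (\<exists>K. \<forall>x\<in>space (bernoulli \<mu>1). norm (g x) \<le> K) \<and>
     (\<forall>x\<in>space (bernoulli \<mu>1). \<forall>y\<in>space (bernoulli \<mu>1). (\<forall>i\<in>J. x i = y i) \<longrightarrow> g x = g y)}"

lemma local_functionsI: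
  assumes "g \<in> borel_measurable (bernoulli \<mu>1)"
    and "\<And>x. x \<in> space (bernoulli \<mu>1) \<Longrightarrow> norm (g x) \<le> K"
    and "\<And>x y. x \<in> space (bernoulli \<mu>1) \<Longrightarrow> y \<in> space (bernoulli \<mu>1) \<Longrightarrow>
      (\<And>i. i \<in> J \<Longrightarrow> x i = y i) \<Longrightarrow> g x = g y"
  shows "g \<in> local_functions \<mu>1 J"
  unfolding local_functions_def
proof (intro CollectI conjI exI ballI impI)
  show "norm (g x) \<le> K" if "x \<in> space (bernoulli \<mu>1)" for x using assms(2)[OF that] .
  show "g x = g y" if "x \<in> space (bernoulli \<mu>1)" "y \<in> space (bernoulli \<mu>1)" "\<forall>i\<in>J. x i = y i" for x y
    using assms(3)[OF that(1,2)] that(3) by blast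
qed (rule assms(1))

lemma local_functionsE:
  assumes "g \<in> local_functions \<mu>1 J"
  obtains K where "\<forall>x\<in>space (bernoulli \<mu>1). norm (g x) \<le> K" "K > 0"
proof -
  from assms have "\<exists>K. \<forall>x\<in>space (bernoulli \<mu>1). norm (g x) \<le> K"
    unfolding local_functions_def by blast
  then obtain K where K: "\<forall>x\<in>space (bernoulli \<mu>1). norm (g x) \<le> K" ..
  \<comment> \<open>Raising the bound to at least 1 makes it positive, so that the bounds of two
    factors can be multiplied.\<close>
  show ?thesis by (rule that[of "max K 1"]) (simp_all add: K le_max_iff_disj)
qed

lemma local_functions_measurable:
  "g \<in> local_functions \<mu>1 J \<Longrightarrow> g \<in> borel_measurable (bernoulli \<mu>1)"
  unfolding local_functions_def by blast

lemma local_functions_eq: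
  "g \<in> local_functions \<mu>1 J \<Longrightarrow> x \<in> space (bernoulli \<mu>1) \<Longrightarrow> y \<in> space (bernoulli \<mu>1) \<Longrightarrow>
    (\<And>i. i \<in> J \<Longrightarrow> x i = y i) \<Longrightarrow> g x = g y"
  unfolding local_functions_def by blast

lemma local_functions_mono: "J \<subseteq> J' \<Longrightarrow> g \<in> local_functions \<mu>1 J \<Longrightarrow> g \<in> local_functions \<mu>1 J'"
  unfolding local_functions_def by blast

lemma local_functions_const: "(\<lambda>_. c) \<in> local_functions \<mu>1 J"
  by (rule local_functionsI[of _ _ "norm c"]) auto

lemma local_functions_add:
  assumes "f \<in> local_functions \<mu>1 J" "g \<in> local_functions \<mu>1 J"
  shows "(\<lambda>x. f x + g x) \<in> local_functions \<mu>1 J"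
proof -
  from local_functionsE[OF assms(1)] obtain K
    where K: "\<forall>x\<in>space (bernoulli \<mu>1). norm (f x) \<le> K" "K > 0" .
  from local_functionsE[OF assms(2)] obtain L
    where L: "\<forall>x\<in>space (bernoulli \<mu>1). norm (g x) \<le> L" "L > 0" .
  note [measurable] = assms[THEN local_functions_measurable]
  show ?thesis
  proof (rule local_functionsI[of _ _ "K + L"])
    fix x y assume "x \<in> space (bernoulli \<mu>1)" "y \<in> space (bernoulli \<mu>1)" "\<And>i. i \<in> J \<Longrightarrow> x i = y i"
    from local_functions_eq[OF assms(1) this] local_functions_eq[OF assms(2) this]
    show "f x + g x = f y + g y" by simp
  qed (auto intro: norm_triangle_mono bspec[OF K(1)] bspec[OF L(1)])
qed

lemma local_functions_mult:
  assumes "f \<in> local_functions \<mu>1 J" "g \<in> local_functions \<mu>1 J"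
  shows "(\<lambda>x. f x * g x) \<in> local_functions \<mu>1 J"
proof -
  from local_functionsE[OF assms(1)] obtain K
    where K: "\<forall>x\<in>space (bernoulli \<mu>1). norm (f x) \<le> K" "K > 0" .
  from local_functionsE[OF assms(2)] obtain L
    where L: "\<forall>x\<in>space (bernoulli \<mu>1). norm (g x) \<le> L" "L > 0" .
  note [measurable] = assms[THEN local_functions_measurable]
  show ?thesis
  proof (rule local_functionsI[of _ _ "K * L"])
    fix x y assume "x \<in> space (bernoulli \<mu>1)" "y \<in> space (bernoulli \<mu>1)" "\<And>i. i \<in> J \<Longrightarrow> x i = y i"
    from local_functions_eq[OF assms(1) this] local_functions_eq[OF assms(2) this]
    show "f x * g x = f y * g y" by simp
  next
    fix x assume "x \<in> space (bernoulli \<mu>1)"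
    then show "norm (f x * g x) \<le> K * L"
      unfolding norm_mult using K(2) by (intro mult_mono bspec[OF K(1)] bspec[OF L(1)]) auto
  qed simp
qed

lemma local_functions_cnj:
  assumes "f \<in> local_functions \<mu>1 J"
  shows "(\<lambda>x. cnj (f x)) \<in> local_functions \<mu>1 J"
proof -
  from local_functionsE[OF assms(1)] obtain K
    where K: "\<forall>x\<in>space (bernoulli \<mu>1). norm (f x) \<le> K" "K > 0" .
  have "(\<lambda>x. cnj (f x)) \<in> borel_measurable (bernoulli \<mu>1)"
    by (rule measurable_compose[OF local_functions_measurable[OF assms]
          borel_measurable_continuous_onI[OF continuous_on_cnj[OF continuous_on_id]]])
  then show ?thesis
    by (rule local_functionsI[of _ _ K]) (simp add: K(1), metis local_functions_eq[OF assms])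
qed

lemma local_functions_sum:
  "(\<And>i. i \<in> I \<Longrightarrow> f i \<in> local_functions \<mu>1 J) \<Longrightarrow> (\<lambda>x. \<Sum>i\<in>I. f i x) \<in> local_functions \<mu>1 J"
  by (induction I rule: infinite_finite_induct)
    (auto intro: local_functions_const local_functions_add)

text \<open>Where \<open>g\<close> reads coordinate \<open>i\<close>, the translate reads
  \<open>i + k\<close>, so the set of coordinates moves by \<open>+k\<close>.\<close>

lemma local_functions_translate:
  fixes k :: int
  assumes "g \<in> local_functions \<mu>1 J"
  shows "(\<lambda>x. g (\<lambda>i. x (i + k))) \<in> local_functions \<mu>1 ((\<lambda>i. i + k) ` J)"
proof -
  from local_functionsE[OF assms(1)] obtain K
    where K: "\<forall>x\<in>space (bernoulli \<mu>1). norm (g x) \<le> K" "K > 0" .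
  have tr: "(\<lambda>i. x (i + k)) \<in> space (bernoulli \<mu>1)" if "x \<in> space (bernoulli \<mu>1)" for x :: "int \<Rightarrow> 'a"
    using measurable_space[OF measurable_translate that] .
  show ?thesis
  proof (rule local_functionsI[of _ _ K])
    show "(\<lambda>x. g (\<lambda>i. x (i + k))) \<in> borel_measurable (bernoulli \<mu>1)"
      by (rule measurable_compose[OF measurable_translate local_functions_measurable[OF assms]])
    fix x y assume "x \<in> space (bernoulli \<mu>1)" "y \<in> space (bernoulli \<mu>1)"
      "\<And>i. i \<in> (\<lambda>i. i + k) ` J \<Longrightarrow> x i = y i"
    then show "g (\<lambda>i. x (i + k)) = g (\<lambda>i. y (i + k))"
      by (intro local_functions_eq[OF assms] tr) auto
  qed (intro bspec[OF K(1)] tr)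
qed

lemma prob_space_bernoulli: "prob_space \<mu>1 \<Longrightarrow> prob_space (bernoulli \<mu>1)"
  unfolding bernoulli_def by (rule prob_space_PiM)

lemma local_functions_integrable:
  assumes "prob_space \<mu>1" "g \<in> local_functions \<mu>1 J"
  shows "integrable (bernoulli \<mu>1) g"
proof -
  interpret prob_space "bernoulli \<mu>1" by (rule prob_space_bernoulli[OF assms(1)])
  from local_functionsE[OF assms(2)] obtain K
    where "\<forall>x\<in>space (bernoulli \<mu>1). norm (g x) \<le> K" "K > 0" .
  then show ?thesis
    by (intro integrable_const_bound[of _ K] AE_I2 local_functions_measurable[OF assms(2)]) auto
qed

section \<open>Density of the cylinder functions in L^1\<close>

text \<open>The symmetric windows increase with \<open>m\<close>, so two cylinder functions share
  one window, and the single number \<open>m\<close> tells how far a window must be shifted to clear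
  0.\<close>

definition cylinder_functions :: "'a measure \<Rightarrow> ((int \<Rightarrow> 'a) \<Rightarrow> complex) set" where
  "cylinder_functions \<mu>1 = (\<Union>m. local_functions \<mu>1 {- int m..int m})"

lemma cylinder_functions_add:
  assumes "f \<in> cylinder_functions \<mu>1" "g \<in> cylinder_functions \<mu>1"
  shows "(\<lambda>x. f x + g x) \<in> cylinder_functions \<mu>1"
proof -
  obtain m n where mn: "f \<in> local_functions \<mu>1 {- int m..int m}" "g \<in> local_functions \<mu>1 {- int n..int n}"
    using assms unfolding cylinder_functions_def by blast
  have "(\<lambda>x. f x + g x) \<in> local_functions \<mu>1 {- int (max m n)..int (max m n)}"
    by (intro local_functions_add local_functions_mono[OF _ mn(1)] local_functions_mono[OF _ mn(2)]) auto
  then show ?thesis unfolding cylinder_functions_def by blast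
qed

lemma cylinder_functions_cmult: "f \<in> cylinder_functions \<mu>1 \<Longrightarrow> (\<lambda>x. c * f x) \<in> cylinder_functions \<mu>1"
  unfolding cylinder_functions_def using local_functions_mult[OF local_functions_const] by fast

text \<open>Dynkin's argument: the sets with approximable indicator contain the generating product
  sets, which are stable under intersection, and they are closed under complements and countable
  disjoint unions.\<close>

lemma indicator_L1_closure_cylinder:
  assumes "prob_space \<mu>1" "A \<in> sets (bernoulli \<mu>1)"
  shows "indicator A \<in> L1_closure (bernoulli \<mu>1) (cylinder_functions \<mu>1)"
proof -
  let ?M = "bernoulli \<mu>1" and ?G = "prod_algebra UNIV (\<lambda>_ :: int. \<mu>1)"
  let ?L = "L1_closure ?M (cylinder_functions \<mu>1)"
  interpret prob_space ?M by (rule prob_space_bernoulli[OF assms(1)])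
  have ind: "integrable ?M (indicator B :: _ \<Rightarrow> complex)" if "B \<in> sets ?M" for B
    using that by (intro integrable_const_bound[of _ 1] borel_measurable_indicator AE_I2) (simp_all add: indicator_def)
  have const: "(\<lambda>_. c) \<in> ?L" for c
    by (rule L1_closure_subset) (auto simp: cylinder_functions_def local_functions_const)
  have add: "(\<lambda>x. f x + g x) \<in> ?L" if "f \<in> ?L" "g \<in> ?L" for f g
    using that by (intro L1_closure_add cylinder_functions_add)
  have cmult: "(\<lambda>x. c * f x) \<in> ?L" if "f \<in> ?L" for f c
    using that by (intro L1_closure_cmult cylinder_functions_cmult)
  have sum: "(\<lambda>x. \<Sum>i<n. f i x) \<in> ?L" if "\<And>i. f i \<in> ?L" for f and n :: nat
    by (induction n) (auto intro: const add that)
  have sets: "sets ?M = sigma_sets (space ?M) ?G"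
    by (simp add: bernoulli_def sets_PiM space_PiM)
  have G: "?G \<subseteq> Pow (space ?M)"
    using prod_algebra_sets_into_space by (simp add: bernoulli_def space_PiM)
  have "A \<in> sigma_sets (space ?M) ?G" using assms(2) unfolding sets .
  with Int_stable_prod_algebra G show ?thesis
  proof (induction rule: sigma_sets_induct_disjoint)
    case (basic A)
    then have A: "A \<in> sets ?M" unfolding sets by auto
    from basic obtain J E where J: "finite J"
      and AE: "A = prod_emb UNIV (\<lambda>_. \<mu>1) J (\<Pi>\<^sub>E j\<in>J. E j)"
      by (auto simp: prod_algebra_def)
    \<comment> \<open>The sum of all absolute values is a crude bound for each of them, so the
      window of radius \<open>m\<close> contains \<open>J\<close>.\<close>
    define m where "m = (\<Sum>j\<in>J. nat \<bar>j\<bar>)"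
    have "nat \<bar>j\<bar> \<le> m" if "j \<in> J" for j
      unfolding m_def using J that by (intro member_le_sum) auto
    then have m: "J \<subseteq> {- int m..int m}" by force
    have "indicator A \<in> local_functions \<mu>1 J"
    proof (rule local_functionsI[of _ _ 1])
      fix x y assume xy: "x \<in> space ?M" "y \<in> space ?M" and "\<And>i. i \<in> J \<Longrightarrow> x i = y i"
      then have "restrict x J = restrict y J" by (intro restrict_ext)
      with xy have "x \<in> A \<longleftrightarrow> y \<in> A"
        by (simp add: AE prod_emb_def bernoulli_def space_PiM)
      then show "indicator A x = (indicator A y :: complex)" by (simp add: indicator_def)
    qed (simp_all add: borel_measurable_indicator[OF A], simp add: indicator_def)
    from local_functions_mono[OF m this] have "indicator A \<in> cylinder_functions \<mu>1"
      unfolding cylinder_functions_def by blast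
    then show ?case using ind[OF A] by (rule L1_closure_subset)
  next
    case empty
    show ?case using const[of 0] by (simp add: indicator_def)
  next
    case (compl A)
    have "(\<lambda>x. 1 + -1 * indicator A x) \<in> ?L" by (intro add const cmult compl)
    then show ?case by (rule L1_closure_cong) (simp add: indicator_def)
  next
    case (union A)
    have U: "(\<Union>i. A i) \<in> sets ?M" using union(2) unfolding sets by (intro sigma_sets.Union) auto
    show ?case
    proof (rule L1_closure_LIMSEQ[where w = "\<lambda>_. 1"])
      show "(\<lambda>x. \<Sum>i<n. indicator (A i) x) \<in> ?L" for n by (rule sum) (rule union)
      \<comment> \<open>By disjointness the partial sums are themselves indicators, hence dominated
        by the constant 1.\<close>
      have eq: "(\<Sum>i<n. indicator (A i) x) = (indicator (\<Union>i<n. A i) x :: complex)" for n x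
        using union(1) by (subst indicator_UN_disjoint) (auto simp: disjoint_family_on_def)
      show "(\<lambda>n. \<Sum>i<n. indicator (A i) x) \<longlonglongrightarrow> (indicator (\<Union>i. A i) x :: complex)" for x
        unfolding eq by (rule LIMSEQ_indicator_UN)
      show "norm (\<Sum>i<n. indicator (A i) x :: complex) \<le> 1" for n x
        unfolding eq by (simp add: indicator_def)
    qed (auto intro: ind U)
  qed
qed

text \<open>Induction over integrable functions reduces the claim to indicators; in its limit step
  the approximants are dominated by twice the norm of \<open>f\<close>.\<close>

lemma integrable_L1_closure_cylinder:
  assumes "prob_space \<mu>1" "integrable (bernoulli \<mu>1) f"
  shows "f \<in> L1_closure (bernoulli \<mu>1) (cylinder_functions \<mu>1)"
  using assms(2)
proof (induction rule: integrable_induct)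
  case (base A c)
  then have "(\<lambda>x. c * indicator A x) \<in> L1_closure (bernoulli \<mu>1) (cylinder_functions \<mu>1)"
    by (intro L1_closure_cmult cylinder_functions_cmult indicator_L1_closure_cylinder assms(1))
  then show ?case by (rule L1_closure_cong) (simp add: indicator_def)
next
  case (add f g)
  then show ?case by (intro L1_closure_add cylinder_functions_add)
next
  case (lim f s)
  show ?case by (rule L1_closure_LIMSEQ[OF lim(5,4) _ lim(2,3)]) (use lim(4) in auto)
qed


lemma local_functions_cong:
  assumes "g \<in> local_functions \<mu>1 J" "\<And>x. x \<in> space (bernoulli \<mu>1) \<Longrightarrow> g x = h x"
  shows "h \<in> local_functions \<mu>1 J"
proof -
  from local_functionsE[OF assms(1)] obtain K
    where K: "\<forall>x\<in>space (bernoulli \<mu>1). norm (g x) \<le> K" "K > 0" .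
  show ?thesis
  proof (rule local_functionsI[of _ _ K])
    show "h \<in> borel_measurable (bernoulli \<mu>1)"
      using local_functions_measurable[OF assms(1)] assms(2) measurable_cong by blast
    show "norm (h x) \<le> K" if "x \<in> space (bernoulli \<mu>1)" for x
      using K(1) that assms(2)[OF that] by auto
    show "h x = h y" if "x \<in> space (bernoulli \<mu>1)" "y \<in> space (bernoulli \<mu>1)" "\<And>i. i \<in> J \<Longrightarrow> x i = y i" for x y
      using local_functions_eq[OF assms(1) that] assms(2)[OF that(1)] assms(2)[OF that(2)] by simp
  qed
qed

section \<open>Functions of the past and of the future\<close>

lemma L1_closure_cnj:
  assumes S: "\<And>f. f \<in> S \<Longrightarrow> (\<lambda>x. cnj (f x)) \<in> S" and f: "f \<in> L1_closure M S"
  shows "(\<lambda>x. cnj (f x)) \<in> L1_closure M S"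
  unfolding L1_closure_def
proof (intro CollectI conjI allI impI)
  show "integrable M (\<lambda>x. cnj (f x))" using L1_closure_integrable[OF f] by simp
  fix \<epsilon> :: real assume "\<epsilon> > 0"
  from L1_closureE[OF f this] obtain g
    where g: "g \<in> S" "integrable M g" "(\<integral>x. norm (f x - g x) \<partial>M) < \<epsilon>" .
  have "norm (cnj (f x) - cnj (g x)) = norm (f x - g x)" for x
    by (simp flip: complex_cnj_diff)
  with S[OF g(1)] g(2,3) show "\<exists>h\<in>S. integrable M h \<and> (\<integral>x. norm (cnj (f x) - h x) \<partial>M) < \<epsilon>"
    by (intro bexI[of _ "\<lambda>x. cnj (g x)"]) auto
qed

text \<open>For \<open>u\<close> bounded by \<open>K\<close>, both sides are linear in
  \<open>f\<close> and continuous in the L^1 norm with constant \<open>K\<close>, so the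
  factorisation passes from \<open>S\<close> to its closure.\<close>

lemma (in prob_space) integral_mult_L1_closure:
  fixes u f :: "'a \<Rightarrow> complex"
  assumes u: "u \<in> borel_measurable M" "AE x in M. norm (u x) \<le> K"
    and f: "f \<in> L1_closure M S"
    and S: "\<And>g. g \<in> S \<Longrightarrow> (\<integral>x. u x * g x \<partial>M) = (\<integral>x. u x \<partial>M) * (\<integral>x. g x \<partial>M)"
  shows "(\<integral>x. u x * f x \<partial>M) = (\<integral>x. u x \<partial>M) * (\<integral>x. f x \<partial>M)"
proof -
  have bound: "integrable M (\<lambda>x. u x * h x)"
      "norm (\<integral>x. u x * h x \<partial>M) \<le> K * (\<integral>x. norm (h x) \<partial>M)"
    if h: "integrable M h" for h :: "'a \<Rightarrow> complex"
  proof -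
    note [measurable] = u(1) borel_measurable_integrable[OF h]
    have le: "AE x in M. norm (u x * h x) \<le> K * norm (h x)"
      using u(2) by eventually_elim (auto simp: norm_mult intro: mult_right_mono)
    show int: "integrable M (\<lambda>x. u x * h x)"
      by (rule Bochner_Integration.integrable_bound[of _ "\<lambda>x. K * norm (h x)"])
        (use h le in auto)
    have "norm (\<integral>x. u x * h x \<partial>M) \<le> (\<integral>x. norm (u x * h x) \<partial>M)" by (rule integral_norm_bound)
    also have "\<dots> \<le> (\<integral>x. K * norm (h x) \<partial>M)"
      by (rule integral_mono_AE) (use int h le in auto)
    finally show "norm (\<integral>x. u x * h x \<partial>M) \<le> K * (\<integral>x. norm (h x) \<partial>M)" by simp
  qed
  \<comment> \<open>Testing the bound on the constant 1, whose integral is 1, shows that the mean of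
    \<open>u\<close> has modulus at most \<open>K\<close>; in particular \<open>K\<close> is
    non-negative.\<close>
  have "0 \<le> norm (\<integral>x. u x \<partial>M)" by simp
  also have "norm (\<integral>x. u x \<partial>M) \<le> K" using bound(2)[of "\<lambda>_. 1"] by (simp add: prob_space)
  finally have K: "K \<ge> 0" .
  note u_le = \<open>norm (\<integral>x. u x \<partial>M) \<le> K\<close>
  note f_int = L1_closure_integrable[OF f]
  let ?d = "(\<integral>x. u x * f x \<partial>M) - (\<integral>x. u x \<partial>M) * (\<integral>x. f x \<partial>M)"
  have "norm ?d \<le> 0"
  proof (rule field_le_epsilon)
    fix \<epsilon> :: real assume "\<epsilon> > 0"
    \<comment> \<open>The error will be at most \<open>2 * K\<close> times the distance of
      \<open>f\<close> and \<open>g\<close>; the added 1 avoids a division by 0 when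
      \<open>K = 0\<close>.\<close>
    then have \<delta>: "\<epsilon> / (2 * K + 1) > 0" using K by simp
    from L1_closureE[OF f \<delta>] obtain g
      where g: "g \<in> S" "integrable M g" "(\<integral>x. norm (f x - g x) \<partial>M) < \<epsilon> / (2 * K + 1)" .
    let ?e = "\<integral>x. norm (f x - g x) \<partial>M"
    have int: "integrable M (\<lambda>x. f x - g x)" using f_int g(2) by simp
    have "(\<integral>x. u x * (f x - g x) \<partial>M) = (\<integral>x. u x * f x \<partial>M) - (\<integral>x. u x * g x \<partial>M)"
      using bound(1)[OF f_int] bound(1)[OF g(2)] by (simp add: right_diff_distrib)
    \<comment> \<open>The factorisation holds for \<open>g\<close>, so its terms cancel and only
      integrals of \<open>f - g\<close> remain.\<close>
    then have "?d = (\<integral>x. u x * (f x - g x) \<partial>M) - (\<integral>x. u x \<partial>M) * (\<integral>x. f x - g x \<partial>M)"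
      using f_int g(2) S[OF g(1)] by (simp add: right_diff_distrib)
    also have "norm \<dots> \<le> norm (\<integral>x. u x * (f x - g x) \<partial>M) +
        norm (\<integral>x. u x \<partial>M) * norm (\<integral>x. f x - g x \<partial>M)"
      by (rule order_trans[OF norm_triangle_ineq4]) (simp only: norm_mult order_refl)
    also have "\<dots> \<le> K * ?e + K * ?e"
      by (intro add_mono bound(2)[OF int] mult_mono u_le integral_norm_bound K) auto
    also have "\<dots> \<le> (2 * K + 1) * ?e" by (simp add: algebra_simps)
    also have "\<dots> \<le> \<epsilon>"
      using g(3) K pos_less_divide_eq[of "2 * K + 1" ?e \<epsilon>] by (simp add: mult.commute)
    finally show "norm ?d \<le> 0 + \<epsilon>" by simp
  qed
  then show ?thesis by simp
qed

section \<open>Independence over disjoint sets of coordinates\<close>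

text \<open>Filling the coordinates outside \<open>J\<close> with a fixed point \<open>a\<close> is
  a measurable map \<open>e\<close>, and \<open>g\<close> does not notice the change. The factored
  form is what independence of restricted families applies to.\<close>

lemma local_functions_factor:
  assumes "prob_space \<mu>1" "g \<in> local_functions \<mu>1 J"
  obtains h where "h \<in> borel_measurable (PiM J (\<lambda>_. \<mu>1))"
    "\<forall>x\<in>space (bernoulli \<mu>1). g x = h (restrict x J)"
proof -
  obtain a where a: "a \<in> space \<mu>1" using prob_space.not_empty[OF assms(1)] by auto
  define e where "e = (\<lambda>(y :: int \<Rightarrow> 'a) i. if i \<in> J then y i else a)"
  have e: "e \<in> PiM J (\<lambda>_. \<mu>1) \<rightarrow>\<^sub>M bernoulli \<mu>1"
    unfolding bernoulli_def
  proof (rule measurable_PiM_single')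
    show "(\<lambda>y. e y i) \<in> PiM J (\<lambda>_. \<mu>1) \<rightarrow>\<^sub>M \<mu>1" for i
      using a by (cases "i \<in> J") (simp_all add: e_def)
  qed (use a in \<open>auto simp: e_def space_PiM\<close>)
  have "g x = (g \<circ> e) (restrict x J)" if x: "x \<in> space (bernoulli \<mu>1)" for x
    unfolding comp_def
    by (rule local_functions_eq[OF assms(2) x])
      (use x a in \<open>auto simp: e_def space_bernoulli\<close>)
  with measurable_comp[OF e local_functions_measurable[OF assms(2)]] show ?thesis
    by (intro that[of "g \<circ> e"]) blast+
qed

text \<open>Each coordinate has law \<mu>1 and the joint law is their product, so the coordinates
  are independent. Hence so are the restrictions to \<open>J\<close> and \<open>J'\<close>, and the
  integral of a product of functions of them factors.\<close>

lemma integral_mult_local_functions: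
  assumes "prob_space \<mu>1" "J \<inter> J' = {}"
    and f: "f \<in> local_functions \<mu>1 J" and g: "g \<in> local_functions \<mu>1 J'"
  shows "(\<integral>x. f x * g x \<partial>bernoulli \<mu>1) = (\<integral>x. f x \<partial>bernoulli \<mu>1) * (\<integral>x. g x \<partial>bernoulli \<mu>1)"
proof -
  let ?M = "bernoulli \<mu>1"
  interpret prob_space ?M by (rule prob_space_bernoulli[OF assms(1)])
  from local_functions_factor[OF assms(1) f] obtain h
    where h: "h \<in> borel_measurable (PiM J (\<lambda>_. \<mu>1))" "\<forall>x\<in>space ?M. f x = h (restrict x J)" .
  from local_functions_factor[OF assms(1) g] obtain h'
    where h': "h' \<in> borel_measurable (PiM J' (\<lambda>_. \<mu>1))" "\<forall>x\<in>space ?M. g x = h' (restrict x J')" .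
  have "indep_vars (\<lambda>_. \<mu>1) (\<lambda>i x. x i) (UNIV :: int set)"
  proof (subst indep_vars_iff_distr_eq_PiM')
    show "(\<lambda>x. x i) \<in> ?M \<rightarrow>\<^sub>M \<mu>1" for i unfolding bernoulli_def by simp
    have "distr ?M \<mu>1 (\<lambda>x. x i) = \<mu>1" for i
      unfolding bernoulli_def using assms(1) by (intro distr_PiM_component) auto
    then show "distr ?M (PiM UNIV (\<lambda>_. \<mu>1)) (\<lambda>x. \<lambda>i\<in>UNIV. x i) = PiM UNIV (\<lambda>i. distr ?M \<mu>1 (\<lambda>x. x i))"
      by (simp add: bernoulli_def restrict_def distr_id[unfolded id_def])
  qed simp
  from indep_var_compose[OF indep_var_restrict[OF this assms(2)] h(1) h'(1)]
  have indep: "indep_var borel (\<lambda>x. h (restrict x J)) borel (\<lambda>x. h' (restrict x J'))"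
    by (simp add: comp_def)
  have eq: "integrable ?M (\<lambda>x. h (restrict x J))" "integrable ?M (\<lambda>x. h' (restrict x J'))"
    using local_functions_integrable[OF assms(1) f] local_functions_integrable[OF assms(1) g] h(2) h'(2)
    by (simp_all cong: Bochner_Integration.integrable_cong)
  from indep_var_lebesgue_integral[OF indep eq] h(2) h'(2) show ?thesis
    by (simp cong: Bochner_Integration.integral_cong)
qed

text \<open>A function of this kind is independent of itself.\<close>

lemma AE_const_if_L1_closure_local_functions:
  assumes "prob_space \<mu>1" "J \<inter> J' = {}" and f: "f \<in> Linf_fun (bernoulli \<mu>1)"
    and fJ: "f \<in> L1_closure (bernoulli \<mu>1) (local_functions \<mu>1 J)"
    and fJ': "f \<in> L1_closure (bernoulli \<mu>1) (local_functions \<mu>1 J')"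
  obtains c where "AE x in bernoulli \<mu>1. f x = c"
proof -
  let ?M = "bernoulli \<mu>1"
  interpret prob_space ?M by (rule prob_space_bernoulli[OF assms(1)])
  obtain K where meas [measurable]: "f \<in> borel_measurable ?M" and K: "AE x in ?M. norm (f x) \<le> K"
    using f by (auto simp: Linf_fun_def)
  note int = L1_closure_integrable[OF fJ]
  \<comment> \<open>First passage to the limit: \<open>f\<close> is approximated by functions of
    \<open>J\<close>, which are independent of the function \<open>g\<close> of
    \<open>J'\<close>.\<close>
  have 1: "(\<integral>x. g x * f x \<partial>?M) = (\<integral>x. g x \<partial>?M) * (\<integral>x. f x \<partial>?M)" if g: "g \<in> local_functions \<mu>1 J'" for g
  proof -
    from local_functionsE[OF g] obtain L where "\<forall>x\<in>space ?M. norm (g x) \<le> L" "L > 0" .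
    then have "AE x in ?M. norm (g x) \<le> L" by (intro AE_I2) auto
    from local_functions_measurable[OF g] this fJ show ?thesis
      by (rule integral_mult_L1_closure)
        (use assms(2) in \<open>auto intro: integral_mult_local_functions[OF assms(1) _ g]\<close>)
  qed
  have cnj_int: "integrable ?M (\<lambda>x. f x * cnj (f x))"
  proof (rule integrable_const_bound[of _ "K * K"])
    show "AE x in ?M. norm (f x * cnj (f x)) \<le> K * K"
      using K
    proof eventually_elim
      case (elim x)
      from mult_mono[OF this this order_trans[OF norm_ge_zero this]] show ?case by (simp add: norm_mult)
    qed
    show "(\<lambda>x. f x * cnj (f x)) \<in> borel_measurable ?M"
      using int by (intro borel_measurable_times borel_measurable_integrable) auto
  qed
  define c where "c = (\<integral>x. f x \<partial>?M)"
  \<comment> \<open>Second passage to the limit: now \<open>f\<close> is the bounded factor and its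
    conjugate is approximated by functions of \<open>J'\<close>, for which the first passage gives
    the factorisation.\<close>
  have "(\<integral>x. f x * cnj (f x) \<partial>?M) = c * cnj c"
    using integral_mult_L1_closure[OF meas K L1_closure_cnj[OF local_functions_cnj fJ']] 1
    by (simp add: c_def mult.commute)
  \<comment> \<open>This expands the variance of \<open>f\<close>. It vanishes by the preceding
    identity, so \<open>f\<close> equals its mean almost everywhere.\<close>
  moreover have "(\<integral>x. (f x - c) * cnj (f x - c) \<partial>?M) =
      (\<integral>x. f x * cnj (f x) \<partial>?M) - (\<integral>x. f x * cnj c \<partial>?M) - (\<integral>x. c * cnj (f x) \<partial>?M) + c * cnj c"
    using int cnj_int by (simp add: ring_distribs prob_space)
  ultimately have "(\<integral>x. (f x - c) * cnj (f x - c) \<partial>?M) = 0"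
    by (simp add: c_def)
  then have "complex_of_real (\<integral>x. (norm (f x - c))\<^sup>2 \<partial>?M) = 0"
    unfolding integral_complex_of_real[symmetric] complex_norm_square .
  moreover have "integrable ?M (\<lambda>x. (norm (f x - c))\<^sup>2)"
  proof -
    have "integrable ?M (\<lambda>x. (f x - c) * cnj (f x - c))"
      using int cnj_int by (simp add: ring_distribs)
    then show ?thesis
      unfolding complex_norm_square[symmetric] by (simp only: complex_of_real_integrable_eq)
  qed
  ultimately have "AE x in ?M. (norm (f x - c))\<^sup>2 = 0"
    by (subst (asm) of_real_eq_0_iff, subst (asm) integral_nonneg_eq_0_iff_AE) auto
  then have "AE x in ?M. f x = c" by eventually_elim simp
  then show ?thesis by (rule that)
qed

section \<open>Functions invariant under a unitary cocycle\<close>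

text \<open>Writes conjugation as a linear combination of the entries of \<open>A\<close>, so that
  scalar estimates in L^1 apply to it.\<close>

lemma conj_mat_index:
  fixes A U :: "complex mat"
  assumes U: "U \<in> carrier_mat n n" and A: "A \<in> carrier_mat n n" and ij: "i < n" "j < n"
  shows "(U * A * mat_adjoint U) $$ (i, j) =
    (\<Sum>b\<in>{0..<n}. \<Sum>a\<in>{0..<n}. U $$ (i, a) * cnj (U $$ (j, b)) * A $$ (a, b))"
proof -
  have "(U * A * mat_adjoint U) $$ (i, j) =
      (\<Sum>b\<in>{0..<n}. (U * A) $$ (i, b) * mat_adjoint U $$ (b, j))"
    by (rule mult_mat_index[OF mult_carrier_mat[OF U A] mat_adjoint_carrier[OF U] ij])
  also have "\<dots> = (\<Sum>b\<in>{0..<n}. \<Sum>a\<in>{0..<n}. U $$ (i, a) * cnj (U $$ (j, b)) * A $$ (a, b))"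
  proof (rule sum.cong[OF refl])
    fix b assume "b \<in> {0..<n}"
    then have b: "b < n" by simp
    show "(U * A) $$ (i, b) * mat_adjoint U $$ (b, j) =
        (\<Sum>a\<in>{0..<n}. U $$ (i, a) * cnj (U $$ (j, b)) * A $$ (a, b))"
      unfolding mult_mat_index[OF U A ij(1) b] mat_adjoint_index[OF b ij(2) U]
      unfolding sum_distrib_right by (simp add: mult_ac)
  qed
  finally show ?thesis .
qed

text \<open>The diagonal entries of the unitarity relation say that every row has Euclidean norm
  1.\<close>

lemma norm_unitary_index_le:
  fixes U :: "complex mat"
  assumes U: "U \<in> carrier_mat n n" "U * mat_adjoint U = 1\<^sub>m n" and ij: "i < n" "j < n"
  shows "norm (U $$ (i, j)) \<le> 1"
proof -
  have "(1 :: complex) = (U * mat_adjoint U) $$ (i, i)" using ij by (simp add: U(2))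
  also have "\<dots> = (\<Sum>k\<in>{0..<n}. U $$ (i, k) * mat_adjoint U $$ (k, i))"
    by (rule mult_mat_index[OF U(1) mat_adjoint_carrier[OF U(1)] ij(1) ij(1)])
  also have "\<dots> = (\<Sum>k\<in>{0..<n}. U $$ (i, k) * cnj (U $$ (i, k)))"
    by (intro sum.cong refl) (simp add: mat_adjoint_index[OF _ ij(1) U(1)])
  also have "\<dots> = of_real (\<Sum>k\<in>{0..<n}. (norm (U $$ (i, k)))\<^sup>2)"
    unfolding of_real_sum complex_norm_square ..
  finally have "(\<Sum>k\<in>{0..<n}. (norm (U $$ (i, k)))\<^sup>2) = 1" by (metis of_real_eq_1_iff)
  moreover have "(norm (U $$ (i, j)))\<^sup>2 \<le> (\<Sum>k\<in>{0..<n}. (norm (U $$ (i, k)))\<^sup>2)"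
    by (rule member_le_sum) (use ij in auto)
  ultimately have "(norm (U $$ (i, j)))\<^sup>2 \<le> 1\<^sup>2" by simp
  then show ?thesis by (rule power2_le_imp_le) simp
qed

lemma integral_translate:
  fixes k :: int and f :: "(int \<Rightarrow> 'a) \<Rightarrow> 'b :: {banach, second_countable_topology}"
  assumes "prob_space \<mu>1" "integrable (bernoulli \<mu>1) f"
  shows "integrable (bernoulli \<mu>1) (\<lambda>x. f (\<lambda>i. x (i + k)))"
    and "(\<integral>x. f (\<lambda>i. x (i + k)) \<partial>bernoulli \<mu>1) = (\<integral>x. f x \<partial>bernoulli \<mu>1)"
proof -
  note d = distr_translate[OF assms(1), of k]
  show "integrable (bernoulli \<mu>1) (\<lambda>x. f (\<lambda>i. x (i + k)))"
    by (rule integrable_distr[OF measurable_translate]) (unfold d, rule assms(2))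
  show "(\<integral>x. f (\<lambda>i. x (i + k)) \<partial>bernoulli \<mu>1) = (\<integral>x. f x \<partial>bernoulli \<mu>1)"
    using integral_distr[OF measurable_translate borel_measurable_integrable[OF assms(2)], of k] d by simp
qed

lemma Linf_fun_integrable:
  assumes "prob_space M" "f \<in> Linf_fun M"
  shows "integrable M f"
proof -
  interpret prob_space M by fact
  show ?thesis using assms(2) by (auto simp: Linf_fun_def intro: integrable_const_bound)
qed

text \<open>All entries must share one window, since they will be translated by the same
  amount.\<close>

lemma cylinder_approximation:
  fixes f :: "nat \<Rightarrow> nat \<Rightarrow> (int \<Rightarrow> 'a) \<Rightarrow> complex"
  assumes "prob_space \<mu>1" "\<And>a b. a < n \<Longrightarrow> b < n \<Longrightarrow> integrable (bernoulli \<mu>1) (f a b)" "\<delta> > 0"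
  obtains m g where "\<forall>a<n. \<forall>b<n. g a b \<in> local_functions \<mu>1 {- int m..int m} \<and>
      (\<integral>x. norm (f a b x - g a b x) \<partial>bernoulli \<mu>1) < \<delta>"
proof -
  have "\<exists>g m. g \<in> local_functions \<mu>1 {- int m..int m} \<and>
      (\<integral>x. norm (f a b x - g x) \<partial>bernoulli \<mu>1) < \<delta>" if "a < n" "b < n" for a b
  proof -
    from L1_closureE[OF integrable_L1_closure_cylinder[OF assms(1) assms(2)[OF that]] assms(3)] obtain g
      where "g \<in> cylinder_functions \<mu>1" "(\<integral>x. norm (f a b x - g x) \<partial>bernoulli \<mu>1) < \<delta>" .
    then show ?thesis unfolding cylinder_functions_def by blast
  qed
  then obtain g m where gm: "\<And>a b. a < n \<Longrightarrow> b < n \<Longrightarrow>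
      g a b \<in> local_functions \<mu>1 {- int (m a b)..int (m a b)} \<and>
      (\<integral>x. norm (f a b x - g a b x) \<partial>bernoulli \<mu>1) < \<delta>" by metis
  define m' where "m' = (\<Sum>a<n. \<Sum>b<n. m a b)"
  have "m a b \<le> m'" if "a < n" "b < n" for a b
  proof -
    have "m a b \<le> (\<Sum>b<n. m a b)" using that by (intro member_le_sum) auto
    also have "\<dots> \<le> m'" unfolding m'_def using that by (intro member_le_sum) auto
    finally show ?thesis .
  qed
  then have "{- int (m a b)..int (m a b)} \<subseteq> {- int m'..int m'}" if "a < n" "b < n" for a b
    using that by force
  with gm show ?thesis by (intro that[of g m'] allI impI conjI) (blast intro: local_functions_mono)+
qed

text \<open>Approximate the entries of \<open>F\<close> on a window, translate the window into
  \<open>J\<close>, and conjugate by \<open>U\<close>, which depends on \<open>J\<close> only. The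
  error does not grow out of control: translation preserves the measure and the entries of
  \<open>U\<close> have modulus at most 1. \<open>U\<close> and \<open>k\<close> may depend on
  \<open>m\<close> because the window is known only after \<epsilon>.\<close>

lemma L1_closure_conj_translate:
  fixes J :: "int set"
  assumes \<mu>1: "prob_space \<mu>1" and F: "F \<in> Linf_mat_fun (bernoulli \<mu>1) n" and ij: "i < n" "j < n"
    and twist: "\<And>m. \<exists>U k. (\<forall>x\<in>space (bernoulli \<mu>1). U x \<in> carrier_mat n n) \<and>
      (\<forall>a<n. \<forall>b<n. (\<forall>x\<in>space (bernoulli \<mu>1). norm (U x $$ (a, b)) \<le> 1) \<and>
        (\<lambda>x. U x $$ (a, b)) \<in> local_functions \<mu>1 J) \<and>
      (\<lambda>i. i + k) ` {- int m..int m} \<subseteq> J \<and>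
      (AE x in bernoulli \<mu>1. F x = U x * F (\<lambda>i. x (i + k)) * mat_adjoint (U x))"
  shows "(\<lambda>x. F x $$ (i, j)) \<in> L1_closure (bernoulli \<mu>1) (local_functions \<mu>1 J)"
  unfolding L1_closure_def
proof (intro CollectI conjI allI impI)
  let ?M = "bernoulli \<mu>1"
  have F_int: "integrable ?M (\<lambda>x. F x $$ (a, b))" if "a < n" "b < n" for a b
    using Linf_fun_integrable[OF prob_space_bernoulli[OF \<mu>1] Linf_mat_fun_entry[OF F that]] .
  from F_int[OF ij] show "integrable ?M (\<lambda>x. F x $$ (i, j))" .
  fix \<epsilon> :: real assume \<epsilon>: "\<epsilon> > 0"
  \<comment> \<open>An entry of a conjugate is a sum of \<open>n * n\<close> terms, each allowed an
    error \<delta>.\<close>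
  define \<delta> where "\<delta> = \<epsilon> / (of_nat n * of_nat n)"
  have n: "n > 0" using ij by simp
  with \<epsilon> have \<delta>: "\<delta> > 0" by (simp add: \<delta>_def)
  from cylinder_approximation[where f = "\<lambda>a b x. F x $$ (a, b)", OF \<mu>1 F_int \<delta>] obtain m g
    where g': "\<forall>a<n. \<forall>b<n. g a b \<in> local_functions \<mu>1 {- int m..int m} \<and>
      (\<integral>x. norm (F x $$ (a, b) - g a b x) \<partial>?M) < \<delta>" .
  have g: "g a b \<in> local_functions \<mu>1 {- int m..int m}"
      "(\<integral>x. norm (F x $$ (a, b) - g a b x) \<partial>?M) < \<delta>" if "a < n" "b < n" for a b
    using g' that by blast+
  from twist[of m] obtain U k where
    U: "\<forall>x\<in>space ?M. U x \<in> carrier_mat n n"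
    and U_ab: "\<forall>a<n. \<forall>b<n. (\<forall>x\<in>space ?M. norm (U x $$ (a, b)) \<le> 1) \<and>
        (\<lambda>x. U x $$ (a, b)) \<in> local_functions \<mu>1 J"
    and k: "(\<lambda>i. i + k) ` {- int m..int m} \<subseteq> J"
    and AE_F: "AE x in ?M. F x = U x * F (\<lambda>i. x (i + k)) * mat_adjoint (U x)"
    by (elim exE conjE)
  have U_le: "norm (U x $$ (a, b)) \<le> 1" if "a < n" "b < n" "x \<in> space ?M" for a b x
    using U_ab that by blast
  have U_loc: "(\<lambda>x. U x $$ (a, b)) \<in> local_functions \<mu>1 J" if "a < n" "b < n" for a b
    using U_ab that by blast
  \<comment> \<open>The formula for the entry of the conjugate, with the translated entries of
    \<open>F\<close> replaced by their approximants.\<close>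
  define h where "h = (\<lambda>x. \<Sum>b\<in>{0..<n}. \<Sum>a\<in>{0..<n}.
    U x $$ (i, a) * cnj (U x $$ (j, b)) * g a b (\<lambda>i. x (i + k)))"
  have "(\<lambda>x. g a b (\<lambda>i. x (i + k))) \<in> local_functions \<mu>1 J" if "a < n" "b < n" for a b
    using local_functions_mono[OF k local_functions_translate[OF g(1)[OF that]]] .
  then have h: "h \<in> local_functions \<mu>1 J"
    unfolding h_def
    by (intro local_functions_sum local_functions_mult local_functions_cnj U_loc ij) auto
  define d where "d = (\<lambda>a b x. norm (F x $$ (a, b) - g a b x))"
  have d_int: "integrable ?M (d a b)" if "a < n" "b < n" for a b
    unfolding d_def using F_int[OF that] local_functions_integrable[OF \<mu>1 g(1)[OF that]] by auto
  note tr = integral_translate[OF \<mu>1 d_int, of _ _ k]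
  have "AE x in ?M. norm (F x $$ (i, j) - h x) \<le> (\<Sum>b\<in>{0..<n}. \<Sum>a\<in>{0..<n}. d a b (\<lambda>i. x (i + k)))"
    using AE_F AE_space
  proof eventually_elim
    case (elim x)
    let ?y = "\<lambda>i. x (i + k)"
    have Fy: "F ?y \<in> carrier_mat n n"
      using Linf_mat_fun_carrier[OF F measurable_space[OF measurable_translate elim(2)]] .
    have "F x $$ (i, j) = (\<Sum>b\<in>{0..<n}. \<Sum>a\<in>{0..<n}. U x $$ (i, a) * cnj (U x $$ (j, b)) * F ?y $$ (a, b))"
      by (subst elim(1)) (rule conj_mat_index[OF bspec[OF U elim(2)] Fy ij])
    then have "F x $$ (i, j) - h x = (\<Sum>b\<in>{0..<n}. \<Sum>a\<in>{0..<n}.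
        U x $$ (i, a) * cnj (U x $$ (j, b)) * (F ?y $$ (a, b) - g a b ?y))"
      by (simp only: h_def right_diff_distrib sum_subtractf)
    also have "norm \<dots> \<le> (\<Sum>b\<in>{0..<n}. \<Sum>a\<in>{0..<n}. d a b ?y)"
    proof (intro sum_norm_le)
      fix a b assume "b \<in> {0..<n}" "a \<in> {0..<n}"
      then have "norm (U x $$ (i, a)) * norm (cnj (U x $$ (j, b))) \<le> 1 * 1"
        by (intro mult_mono) (simp_all add: U_le ij elim)
      then show "norm (U x $$ (i, a) * cnj (U x $$ (j, b)) * (F ?y $$ (a, b) - g a b ?y)) \<le> d a b ?y"
        unfolding d_def norm_mult by (intro mult_left_le_one_le) auto
    qed
    finally show ?case .
  qed
  then have "(\<integral>x. norm (F x $$ (i, j) - h x) \<partial>?M) \<le>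
      (\<integral>x. (\<Sum>b\<in>{0..<n}. \<Sum>a\<in>{0..<n}. d a b (\<lambda>i. x (i + k))) \<partial>?M)"
    using F_int[OF ij] local_functions_integrable[OF \<mu>1 h] tr(1)
    by (intro integral_mono_AE Bochner_Integration.integrable_sum) auto
  \<comment> \<open>Invariance of the measure removes the translation from each error term.\<close>
  also have "\<dots> = (\<Sum>b\<in>{0..<n}. \<Sum>a\<in>{0..<n}. (\<integral>x. d a b x \<partial>?M))"
  proof -
    have "(\<integral>x. (\<Sum>a\<in>{0..<n}. d a b (\<lambda>i. x (i + k))) \<partial>?M) = (\<Sum>a\<in>{0..<n}. (\<integral>x. d a b x \<partial>?M))"
      if "b \<in> {0..<n}" for b
      using tr that by (subst Bochner_Integration.integral_sum) auto
    then show ?thesis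
      using tr(1) by (subst Bochner_Integration.integral_sum) (auto intro!: Bochner_Integration.integrable_sum)
  qed
  also have "\<dots> < (\<Sum>b\<in>{0..<n}. \<Sum>a\<in>{0..<n}. \<delta>)"
    using g(2) n unfolding d_def by (intro sum_strict_mono) auto
  also have "\<dots> = \<epsilon>" using n by (simp add: \<delta>_def)
  finally show "\<exists>h\<in>local_functions \<mu>1 J. integrable ?M h \<and> (\<integral>x. norm (F x $$ (i, j) - h x) \<partial>?M) < \<epsilon>"
    using h local_functions_integrable[OF \<mu>1 h] by blast
qed

section \<open>Iterates of the cocycle and constancy of invariant functions\<close>

text \<open>This is the product w(x) w(T x) ... w(T^(k-1) x).\<close>

primrec cocycle_iterate :: "nat \<Rightarrow> ((int \<Rightarrow> 'a) \<Rightarrow> complex mat) \<Rightarrow> nat \<Rightarrow> (int \<Rightarrow> 'a) \<Rightarrow> complex mat" where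
  "cocycle_iterate n w 0 x = 1\<^sub>m n"
| "cocycle_iterate n w (Suc k) x = w x * cocycle_iterate n w k (\<lambda>i. x (i + 1))"

text \<open>\<open>F\<close> represents a class, so its invariance holds only almost everywhere,
  whereas \<open>w\<close> is a concrete function, unitary at every point of the space.\<close>

locale unitary_cocycle =
  fixes \<mu>1 :: "'a measure" and n :: nat and w F :: "(int \<Rightarrow> 'a) \<Rightarrow> complex mat"
  assumes prob_\<mu>1: "prob_space \<mu>1"
    and w_carrier: "\<And>x. x \<in> space (bernoulli \<mu>1) \<Longrightarrow> w x \<in> carrier_mat n n"
    and w_unitary: "\<And>x. x \<in> space (bernoulli \<mu>1) \<Longrightarrow> w x * mat_adjoint (w x) = 1\<^sub>m n"
    and w_local: "\<And>a b. a < n \<Longrightarrow> b < n \<Longrightarrow> (\<lambda>x. w x $$ (a, b)) \<in> local_functions \<mu>1 {0}"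
    and F: "F \<in> Linf_mat_fun (bernoulli \<mu>1) n"
    and F_invariant: "AE x in bernoulli \<mu>1. F x = w x * F (\<lambda>i. x (i + 1)) * mat_adjoint (w x)"
begin

abbreviation "M \<equiv> bernoulli \<mu>1"
abbreviation "V \<equiv> cocycle_iterate n w"

lemma translate_space: "x \<in> space M \<Longrightarrow> (\<lambda>i. x (i + k)) \<in> space M" for k :: int
  using measurable_space[OF measurable_translate] .

lemma F_carrier: "x \<in> space M \<Longrightarrow> F x \<in> carrier_mat n n"
  by (rule Linf_mat_fun_carrier[OF F])

lemma V_carrier: "x \<in> space M \<Longrightarrow> V k x \<in> carrier_mat n n"
  by (induction k arbitrary: x) (auto intro!: mult_carrier_mat w_carrier translate_space)

lemma V_unitary: "x \<in> space M \<Longrightarrow> V k x * mat_adjoint (V k x) = 1\<^sub>m n"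
proof (induction k arbitrary: x)
  case 0
  have "mat_adjoint (1\<^sub>m n) = (1\<^sub>m n :: complex mat)"
    by (rule eq_matI) (auto simp: mat_adjoint_index[OF _ _ one_carrier_mat])
  then show ?case by simp
next
  case (Suc k)
  let ?V = "V k (\<lambda>i. x (i + 1))"
  note w = w_carrier[OF Suc.prems] and V = V_carrier[OF translate_space[OF Suc.prems], of k 1]
  note w' = mat_adjoint_carrier[OF w] and V' = mat_adjoint_carrier[OF V]
  have "V (Suc k) x * mat_adjoint (V (Suc k) x) = w x * ?V * (mat_adjoint ?V * mat_adjoint (w x))"
    by (simp add: mat_adjoint_mult[OF w V])
  also have "\<dots> = w x * (?V * mat_adjoint ?V) * mat_adjoint (w x)"
    using w V w' V' by (simp add: assoc_mult_mat[of _ n n _ n _ n] mult_carrier_mat[of _ n n _ n])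
  also have "\<dots> = 1\<^sub>m n"
    using w_unitary[OF Suc.prems] Suc.IH[OF translate_space[OF Suc.prems]] right_mult_one_mat[OF w]
    by simp
  finally show ?case .
qed

lemma V_unitary': "x \<in> space M \<Longrightarrow> mat_adjoint (V k x) * V k x = 1\<^sub>m n"
  by (rule mat_mult_left_right_inverse[OF V_carrier mat_adjoint_carrier[OF V_carrier] V_unitary])

text \<open>The translate in the recursion moves the coordinates \<open>{0..<k}\<close> to
  \<open>{1..<k+1}\<close>, and the new factor \<open>w\<close> adds coordinate 0.\<close>

lemma V_local:
  "a < n \<Longrightarrow> b < n \<Longrightarrow> (\<lambda>x. V k x $$ (a, b)) \<in> local_functions \<mu>1 {0..<int k}"
proof (induction k arbitrary: a b)
  case 0
  then show ?case by (simp add: local_functions_const)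
next
  case (Suc k)
  have tr: "(\<lambda>x. V k (\<lambda>i. x (i + 1)) $$ (l, b)) \<in> local_functions \<mu>1 {0..<int (Suc k)}" if "l < n" for l
    by (rule local_functions_mono[OF _ local_functions_translate[OF Suc.IH[OF that Suc.prems(2)]]]) auto
  have w: "(\<lambda>x. w x $$ (a, l)) \<in> local_functions \<mu>1 {0..<int (Suc k)}" if "l < n" for l
    by (rule local_functions_mono[OF _ w_local[OF Suc.prems(1) that]]) auto
  have "(\<lambda>x. \<Sum>l\<in>{0..<n}. w x $$ (a, l) * V k (\<lambda>i. x (i + 1)) $$ (l, b))
      \<in> local_functions \<mu>1 {0..<int (Suc k)}"
    by (intro local_functions_sum local_functions_mult tr w) auto
  moreover have "(\<Sum>l\<in>{0..<n}. w x $$ (a, l) * V k (\<lambda>i. x (i + 1)) $$ (l, b)) = V (Suc k) x $$ (a, b)"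
    if "x \<in> space M" for x
    using mult_mat_index[OF w_carrier[OF that] V_carrier[OF translate_space[OF that]] Suc.prems, of k 1]
    by simp
  ultimately show ?case by (rule local_functions_cong)
qed

lemma V_F: "AE x in M. F x = V k x * F (\<lambda>i. x (i + int k)) * mat_adjoint (V k x)"
proof (induction k)
  case 0
  have "mat_adjoint (1\<^sub>m n) = (1\<^sub>m n :: complex mat)"
    by (rule eq_matI) (auto simp: mat_adjoint_index[OF _ _ one_carrier_mat])
  then show ?case
    using left_mult_one_mat[OF F_carrier] right_mult_one_mat[OF F_carrier] by (intro AE_I2) simp
next
  case (Suc k)
  \<comment> \<open>The induction hypothesis is needed at T x; its exceptional set stays null
    because T preserves the measure.\<close>
  from F_invariant AE_translate[OF prob_\<mu>1 Suc.IH, of 1] AE_space show ?case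
  proof eventually_elim
    case (elim x)
    let ?V = "V k (\<lambda>i. x (i + 1))" and ?F = "F (\<lambda>i. x (i + int (Suc k)))"
    note w = w_carrier[OF elim(3)] and V = V_carrier[OF translate_space[OF elim(3)], of k 1]
    note w' = mat_adjoint_carrier[OF w] and V' = mat_adjoint_carrier[OF V]
    note F' = F_carrier[OF translate_space[OF elim(3)], of "int (Suc k)"]
    have "F (\<lambda>i. x (i + 1)) = ?V * ?F * mat_adjoint ?V"
      using elim(2) by (simp add: add.assoc add.commute add.left_commute)
    with elim(1) have "F x = w x * (?V * ?F * mat_adjoint ?V) * mat_adjoint (w x)" by simp
    also have "\<dots> = V (Suc k) x * ?F * mat_adjoint (V (Suc k) x)"
      using w V w' V' F'
      by (simp add: mat_adjoint_mult[OF w V] assoc_mult_mat[of _ n n _ n _ n] mult_carrier_mat[of _ n n _ n])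
    finally show ?case .
  qed
qed

text \<open>\<open>V_F\<close> at T^(-k) x, solved for F(x) by unitarity. The double adjoint keeps
  the shape that \<open>L1_closure_conj_translate\<close> asks for, with the adjoint of the iterate
  as \<open>U\<close>.\<close>

lemma V_F_back:
  "AE x in M. F x = mat_adjoint (V k (\<lambda>i. x (i + - int k))) * F (\<lambda>i. x (i + - int k)) *
     mat_adjoint (mat_adjoint (V k (\<lambda>i. x (i + - int k))))"
  using AE_translate[OF prob_\<mu>1 V_F[of k], of "- int k"] AE_space
proof eventually_elim
  case (elim x)
  note V = V_carrier[OF translate_space[OF elim(2)], of k "- int k"]
  note u = V_unitary'[OF translate_space[OF elim(2)], of k "- int k"]
    V_unitary[OF translate_space[OF elim(2)], of k "- int k"]
  have eq: "F (\<lambda>i. x (i + - int k)) =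
      V k (\<lambda>i. x (i + - int k)) * F x * mat_adjoint (V k (\<lambda>i. x (i + - int k)))"
    using elim(1) by simp
  show ?case
    unfolding mat_adjoint_adjoint[OF V] eq
    by (rule unitary_conj(5)[OF V u F_carrier[OF elim(2)] F_carrier[OF elim(2)], symmetric])
qed

text \<open>Translation by \<open>m\<close> moves the window [-m, m] to [0, 2m], and the m-th
  iterate sees only the coordinates from 0 to m-1.\<close>

lemma F_future:
  assumes "i < n" "j < n"
  shows "(\<lambda>x. F x $$ (i, j)) \<in> L1_closure M (local_functions \<mu>1 {0..})"
proof (rule L1_closure_conj_translate[OF prob_\<mu>1 F assms], intro exI conjI allI impI ballI)
  fix m :: nat
  show "V m x \<in> carrier_mat n n" if "x \<in> space M" for x by (rule V_carrier[OF that])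
  show "norm (V m x $$ (a, b)) \<le> 1" if "a < n" "b < n" "x \<in> space M" for a b x
    by (rule norm_unitary_index_le[OF V_carrier[OF that(3)] V_unitary[OF that(3)] that(1,2)])
  show "(\<lambda>x. V m x $$ (a, b)) \<in> local_functions \<mu>1 {0..}" if "a < n" "b < n" for a b
    by (rule local_functions_mono[OF _ V_local[OF that]]) auto
  show "(\<lambda>i. i + int m) ` {- int m..int m} \<subseteq> {0..}" by auto
qed (rule V_F)

lemma F_past:
  assumes "i < n" "j < n"
  shows "(\<lambda>x. F x $$ (i, j)) \<in> L1_closure M (local_functions \<mu>1 {..<0})"
proof (rule L1_closure_conj_translate[OF prob_\<mu>1 F assms], intro exI conjI allI impI ballI)
  fix m :: nat
  \<comment> \<open>The past excludes 0, so the window must move by m+1 rather than m: it becomes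
    [-2m-1, -1], and the iterate sees the coordinates from -m-1 to -1.\<close>
  let ?k = "- int (Suc m)"
  let ?U = "\<lambda>x. mat_adjoint (V (Suc m) (\<lambda>i. x (i + ?k)))"
  show U: "?U x \<in> carrier_mat n n" if "x \<in> space M" for x
    by (rule mat_adjoint_carrier[OF V_carrier[OF translate_space[OF that]]])
  show "norm (?U x $$ (a, b)) \<le> 1" if ab: "a < n" "b < n" and x: "x \<in> space M" for a b x
  proof (rule norm_unitary_index_le[OF U[OF x] _ ab])
    show "?U x * mat_adjoint (?U x) = 1\<^sub>m n"
      unfolding mat_adjoint_adjoint[OF V_carrier[OF translate_space[OF x]]]
      by (rule V_unitary'[OF translate_space[OF x]])
  qed
  show "(\<lambda>x. ?U x $$ (a, b)) \<in> local_functions \<mu>1 {..<0}" if ab: "a < n" "b < n" for a b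
  proof (rule local_functions_cong)
    show "(\<lambda>x. cnj (V (Suc m) (\<lambda>i. x (i + ?k)) $$ (b, a))) \<in> local_functions \<mu>1 {..<0}"
      by (rule local_functions_cnj, rule local_functions_mono[OF _ local_functions_translate[OF V_local[OF ab(2,1)]]])
        auto
    show "cnj (V (Suc m) (\<lambda>i. x (i + ?k)) $$ (b, a)) = ?U x $$ (a, b)" if "x \<in> space M" for x
      by (simp only: mat_adjoint_index[OF ab V_carrier[OF translate_space[OF that]]] conjugate_complex_def)
  qed
  show "(\<lambda>i. i + ?k) ` {- int m..int m} \<subseteq> {..<0}" by auto
qed (rule V_F_back)

text \<open>Past and future are disjoint sets of coordinates, so each entry is almost everywhere
  constant; finitely many exceptional null sets are then combined.\<close>

lemma F_constant:
  obtains A where "A \<in> carrier_mat n n" "AE x in M. F x = A"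
proof -
  have "\<exists>c. AE x in M. F x $$ (i, j) = c" if "i < n" "j < n" for i j
    by (rule AE_const_if_L1_closure_local_functions[OF prob_\<mu>1 _ Linf_mat_fun_entry[OF F that]
          F_past[OF that] F_future[OF that]]) auto
  then obtain c where c: "\<And>i j. i < n \<Longrightarrow> j < n \<Longrightarrow> AE x in M. F x $$ (i, j) = c i j" by metis
  define A where "A = mat n n (\<lambda>(i, j). c i j)"
  have A: "A \<in> carrier_mat n n" by (simp add: A_def)
  then have "(\<lambda>_. A) \<in> Linf_mat_fun M n" by (simp add: Linf_mat_fun_def Linf_fun_const)
  from Linf_mat_AE_iff[OF F this] c have "AE x in M. F x = A" by (simp add: A_def)
  with A show ?thesis by (rule that)
qed

end

section \<open>Fixed points\<close>

lemma scalars_ae_algebra: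
  assumes "pointwise_closed S B"
  shows "scalars (ae_algebra M S B) = {ae_class M S (\<lambda>_. c \<odot>\<^bsub>B\<^esub> \<one>\<^bsub>B\<^esub>) | c. True}"
proof -
  have one: "(\<lambda>_. \<one>\<^bsub>B\<^esub>) \<in> S" using assms by (simp add: pointwise_closed_def)
  have "\<one>\<^bsub>ae_algebra M S B\<^esub> = ae_class M S (\<lambda>_. \<one>\<^bsub>B\<^esub>)" by (simp add: ae_algebra_def)
  then show ?thesis by (simp add: scalars_def ae_algebra_class(3)[OF one one])
qed

text \<open>Scalars are fixed because \<phi> is linear and unital. For the converse, a fixed class
  gives a representative invariant under \<Phi> almost everywhere, to which \<open>const\<close>
  applies.\<close>

lemma fixed_points_ae_algebra_eq_scalars:
  assumes cl: "pointwise_closed S B" and aut: "star_automorphism (ae_algebra M S B) \<phi>"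
    and \<phi>: "\<And>f. f \<in> S \<Longrightarrow> \<phi> (ae_class M S f) = ae_class M S (\<Phi> f) \<and> \<Phi> f \<in> S"
    and const: "\<And>f. f \<in> S \<Longrightarrow> AE x in M. f x = \<Phi> f x \<Longrightarrow> \<exists>c. AE x in M. f x = c \<odot>\<^bsub>B\<^esub> \<one>\<^bsub>B\<^esub>"
  shows "fixed_points (ae_algebra M S B) \<phi> = scalars (ae_algebra M S B)"
proof
  let ?A = "ae_algebra M S B"
  have car: "carrier ?A = ae_class M S ` S" by (simp add: ae_algebra_def)
  have one: "(\<lambda>_. \<one>\<^bsub>B\<^esub>) \<in> S" "(\<lambda>_. c \<odot>\<^bsub>B\<^esub> \<one>\<^bsub>B\<^esub>) \<in> S" for c
    using cl by (simp_all add: pointwise_closed_def)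
  have one_A: "\<one>\<^bsub>?A\<^esub> = ae_class M S (\<lambda>_. \<one>\<^bsub>B\<^esub>)" by (simp add: ae_algebra_def)
  show "fixed_points ?A \<phi> \<subseteq> scalars ?A"
  proof
    fix a assume "a \<in> fixed_points ?A \<phi>"
    then obtain f where f: "f \<in> S" "a = ae_class M S f" "\<phi> (ae_class M S f) = ae_class M S f"
      by (auto simp: fixed_points_def car)
    from f(3) \<phi>[OF f(1)] have "AE x in M. f x = \<Phi> f x"
      using ae_class_eq_iff[OF f(1), of "\<Phi> f" M] by simp
    from const[OF f(1) this] obtain c where "AE x in M. f x = c \<odot>\<^bsub>B\<^esub> \<one>\<^bsub>B\<^esub>" ..
    from ae_class_cong[OF this] show "a \<in> scalars ?A"
      unfolding scalars_ae_algebra[OF cl] f(2) by blast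
  qed
  show "scalars ?A \<subseteq> fixed_points ?A \<phi>"
  proof
    fix a assume "a \<in> scalars ?A"
    then obtain c where a: "a = c \<odot>\<^bsub>?A\<^esub> \<one>\<^bsub>?A\<^esub>" by (auto simp: scalars_def)
    have 1: "\<one>\<^bsub>?A\<^esub> \<in> carrier ?A" using one(1) by (simp add: one_A car)
    have "a \<in> carrier ?A"
      using one(2)[of c] by (simp add: a one_A car ae_algebra_class(3)[OF one(1) one(1)])
    moreover have "\<phi> a = a"
      using aut 1 unfolding star_automorphism_def a by simp
    ultimately show "a \<in> fixed_points ?A \<phi>" by (simp add: fixed_points_def)
  qed
qed

lemma fixed_points_alpha:
  fixes \<mu>1 :: "'a measure"
  assumes "prob_space \<mu>1"
  shows "fixed_points (Linf (bernoulli \<mu>1)) (alpha \<mu>1) = scalars (Linf (bernoulli \<mu>1))"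
  unfolding Linf_def
proof (rule fixed_points_ae_algebra_eq_scalars[where \<Phi> = "\<lambda>f x. f (\<lambda>i. x (i + 1))"])
  let ?M = "bernoulli \<mu>1"
  show "pointwise_closed (Linf_fun ?M) complex_algebra" by (rule pointwise_closed_Linf)
  show "star_automorphism (ae_algebra ?M (Linf_fun ?M) complex_algebra) (alpha \<mu>1)"
    using star_automorphism_alpha[OF assms] unfolding Linf_def .
  fix f assume f: "f \<in> Linf_fun ?M"
  show "alpha \<mu>1 (Linf_class ?M f) = Linf_class ?M (\<lambda>x. f (\<lambda>i. x (i + 1))) \<and>
      (\<lambda>x. f (\<lambda>i. x (i + 1))) \<in> Linf_fun ?M"
    using alpha_class[OF assms f] Linf_fun_translate[OF assms f] by blast
  assume inv: "AE x in ?M. f x = f (\<lambda>i. x (i + 1))"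
  have adj: "mat_adjoint (1\<^sub>m 1) = (1\<^sub>m 1 :: complex mat)"
    by (rule eq_matI) (auto simp: mat_adjoint_index[OF _ _ one_carrier_mat])
  \<comment> \<open>A scalar function is a 1 by 1 matrix function; the cocycle is trivial.\<close>
  let ?F = "\<lambda>x. mat 1 1 (\<lambda>_. f x)"
  interpret unitary_cocycle \<mu>1 1 "\<lambda>_. 1\<^sub>m 1" ?F
  proof (rule unitary_cocycle.intro)
    show "?F \<in> Linf_mat_fun ?M 1" using f by (simp add: Linf_mat_fun_def)
    show "AE x in ?M. ?F x = 1\<^sub>m 1 * ?F (\<lambda>i. x (i + 1)) * mat_adjoint (1\<^sub>m 1)"
      using inv
    proof eventually_elim
      case (elim x)
      have "mat 1 1 (\<lambda>_. c) \<in> carrier_mat 1 1" for c :: complex by simp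
      from left_mult_one_mat[OF this] right_mult_one_mat[OF this] elim show ?case
        unfolding adj by simp
    qed
  qed (simp_all only: adj assms one_carrier_mat left_mult_one_mat[OF one_carrier_mat] local_functions_const)
  obtain A where "AE x in ?M. ?F x = A" by (rule F_constant)
  then have "AE x in ?M. f x = A $$ (0, 0)" by eventually_elim auto
  then show "\<exists>c. AE x in ?M. f x = c \<odot>\<^bsub>complex_algebra\<^esub> \<one>\<^bsub>complex_algebra\<^esub>"
    by (auto simp: complex_algebra_def)
qed

text \<open>This evaluates an almost sure identity at a point with a prescribed coordinate.
  Otherwise coordinate \<open>i\<close> would avoid \<open>s\<close> almost surely, and its law
  \<mu>1 would give \<open>{s}\<close> mass 0.\<close>

lemma AE_bernoulli_obtain_coordinate:
  assumes "prob_space \<mu>1" "{s} \<in> sets \<mu>1" "measure \<mu>1 {s} > 0" "AE x in bernoulli \<mu>1. P x"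
  obtains x where "x \<in> space (bernoulli \<mu>1)" "x i = s" "P x"
proof (rule ccontr)
  assume "\<not> thesis"
  with that have no: "\<not> P x" if "x \<in> space (bernoulli \<mu>1)" "x i = s" for x
    using that by blast
  have distr: "distr (bernoulli \<mu>1) \<mu>1 (\<lambda>x. x i) = \<mu>1"
    unfolding bernoulli_def using assms(1) by (intro distr_PiM_component) auto
  have sub: "{y \<in> space \<mu>1. y = s} = {s}" using sets.sets_into_space[OF assms(2)] by auto
  have meas: "(\<lambda>x. x i) \<in> bernoulli \<mu>1 \<rightarrow>\<^sub>M \<mu>1" unfolding bernoulli_def by simp
  have ms: "{y \<in> space \<mu>1. y \<noteq> s} \<in> sets \<mu>1"
    using sets.compl_sets[OF assms(2)] by (simp add: set_diff_eq)
  have "AE x in bernoulli \<mu>1. x i \<noteq> s"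
    using assms(4) AE_space by eventually_elim (use no in blast)
  then have "AE y in distr (bernoulli \<mu>1) \<mu>1 (\<lambda>x. x i). y \<noteq> s"
    by (subst AE_distr_iff[OF meas ms])
  then have "AE y in \<mu>1. y \<noteq> s" unfolding distr .
  then have "emeasure \<mu>1 {s} = 0"
    using AE_iff_measurable[OF assms(2), of "\<lambda>y. y \<noteq> s"] sub by simp
  with assms(3) show False by (simp add: measure_def)
qed

section \<open>The commutant of the clock and shift matrices\<close>

text \<open>The root is primitive: equal powers have exponents congruent modulo \<open>n\<close>,
  and both exponents lie below \<open>n\<close>.\<close>

lemma clock_root_power_inj:
  assumes "i < n" "j < n" "clock_root n ^ i = clock_root n ^ j"
  shows "i = j"
proof -
  have "clock_root n ^ k = exp (2 * of_real pi * \<i> * of_nat k / of_nat n)" for k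
    unfolding clock_root_def exp_of_nat_mult[symmetric] by (simp add: mult_ac)
  with assms complex_root_unity_eq[of n i j] show ?thesis by simp
qed

text \<open>Commuting with the clock matrix forces a matrix to be diagonal, and commuting with the cyclic
  shift then makes its diagonal constant.\<close>

lemma clock_shift_commutant:
  assumes A: "A \<in> carrier_mat n n" and n: "n > 0"
    and u: "clock_mat n * A * mat_adjoint (clock_mat n) = A"
    and v: "shift_mat n * A * mat_adjoint (shift_mat n) = A"
  obtains c where "A = c \<cdot>\<^sub>m 1\<^sub>m n"
proof -
  have diag: "A $$ (i, j) = 0" if ij: "i < n" "j < n" "i \<noteq> j" for i j
  proof (rule ccontr)
    assume nz: "A $$ (i, j) \<noteq> 0"
    have "A $$ (i, j) = (\<Sum>b\<in>{0..<n}. \<Sum>a\<in>{0..<n}. clock_mat n $$ (i, a) * cnj (clock_mat n $$ (j, b)) * A $$ (a, b))"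
      using conj_mat_index[OF clock_mat_carrier A ij(1,2)] u by simp
    also have "\<dots> = (\<Sum>b\<in>{0..<n}. \<Sum>a\<in>{0..<n}. if a = i then (if b = j then
        clock_root n ^ i * cnj (clock_root n ^ j) * A $$ (i, j) else 0) else 0)"
      using ij by (intro sum.cong refl) (auto simp: clock_mat_def)
    also have "\<dots> = clock_root n ^ i * cnj (clock_root n ^ j) * A $$ (i, j)"
      using ij by (simp add: sum.delta)
    \<comment> \<open>Conjugation by the clock matrix multiplies entry (i, j) by this unimodular
      factor, so a non-zero entry forces the factor to be 1.\<close>
    finally have "clock_root n ^ i * cnj (clock_root n ^ j) = 1" using nz by simp
    then have "clock_root n ^ j = clock_root n ^ i * (cnj (clock_root n ^ j) * clock_root n ^ j)"
      by (simp only: mult.assoc[symmetric] mult_1)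
    also have "\<dots> = clock_root n ^ i"
      by (simp add: cnj_clock_root flip: power_mult_distrib)
    finally show False using clock_root_power_inj[OF ij(2,1)] ij(3) by simp
  qed
  have A_eq: "A = mat n n (\<lambda>(i, j). if i = j then A $$ (i, i) else 0)"
    using A diag by (intro eq_matI) auto
  \<comment> \<open>Conjugating a diagonal matrix by the cyclic shift moves its diagonal by one
    place.\<close>
  have step: "A $$ (i, i) = A $$ ((i + 1) mod n, (i + 1) mod n)" if "i < n" for i
    using shift_conj_index[OF A_eq that that] v by simp
  have const: "A $$ (i, i) = A $$ (0, 0)" if "i < n" for i
    using that
  proof (induction i)
    case (Suc i)
    \<comment> \<open>Since \<open>Suc i < n\<close>, the cyclic successor does not wrap
      around.\<close>
    then have i: "i < n" and eq: "(i + 1) mod n = Suc i" by auto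
    from step[OF i] Suc.IH[OF i] show ?case unfolding eq by (rule trans[OF sym])
  qed simp
  have "A = A $$ (0, 0) \<cdot>\<^sub>m 1\<^sub>m n"
  proof (rule eq_matI)
    fix i j assume "i < dim_row (A $$ (0, 0) \<cdot>\<^sub>m 1\<^sub>m n)" "j < dim_col (A $$ (0, 0) \<cdot>\<^sub>m 1\<^sub>m n)"
    then have "i < n" "j < n" by simp_all
    then show "A $$ (i, j) = (A $$ (0, 0) \<cdot>\<^sub>m 1\<^sub>m n) $$ (i, j)"
      using diag[of i j] const[of i] by (cases "i = j") simp_all
  qed (use A in simp_all)
  then show ?thesis by (rule that)
qed

section \<open>Fixed points of the matrix extension\<close>

text \<open>Gives \<beta> on representatives, in the form in which invariance is the cocycle
  equation of \<open>unitary_cocycle\<close>.\<close>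

lemma beta_class:
  fixes \<mu>1 :: "'a measure" and n :: nat
  assumes "prob_space \<mu>1" "C \<in> sets (bernoulli \<mu>1)" "D = space (bernoulli \<mu>1) - C"
    and F: "F \<in> Linf_mat_fun (bernoulli \<mu>1) n"
  defines "w \<equiv> \<lambda>x. if x \<in> C then mat_adjoint (clock_mat n) else mat_adjoint (shift_mat n)"
  shows "beta \<mu>1 n C D (Linf_mat_class (bernoulli \<mu>1) n F) =
      Linf_mat_class (bernoulli \<mu>1) n (\<lambda>x. w x * F (\<lambda>i. x (i + 1)) * mat_adjoint (w x))"
    and "(\<lambda>x. w x * F (\<lambda>i. x (i + 1)) * mat_adjoint (w x)) \<in> Linf_mat_fun (bernoulli \<mu>1) n"
proof -
  let ?M = "bernoulli \<mu>1" let ?S = "Linf_mat_fun ?M n"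
  have w_class: "cocycle_unitary ?M n C D = Linf_mat_class ?M n w" and w: "w \<in> ?S"
    using cocycle_unitary_class[OF assms(2,3), of n] by (simp_all add: w_def)
  have mult: "(\<lambda>x. F x * G x) \<in> ?S" if "F \<in> ?S" "G \<in> ?S" for F G
    using pointwise_closed_Linf_mat[of ?M n] that by (auto simp: pointwise_closed_def mat_algebra_def)
  have adj: "(\<lambda>x. mat_adjoint (F x)) \<in> ?S" if "F \<in> ?S" for F
    using pointwise_closed_Linf_mat[of ?M n] that by (auto simp: pointwise_closed_def mat_algebra_def)
  note tr = Linf_mat_fun_translate[OF assms(1)]
  show "beta \<mu>1 n C D (Linf_mat_class ?M n F) =
      Linf_mat_class ?M n (\<lambda>x. w x * F (\<lambda>i. x (i + 1)) * mat_adjoint (w x))"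
    unfolding beta_def comp_def tensor_id_alpha_class[OF assms(1) F] Ad_def w_class
    by (simp add: Linf_mat_def ae_algebra_class[OF w w] ae_algebra_class[OF w tr[OF F]]
        ae_algebra_class[OF mult[OF w tr[OF F]] adj[OF w]] mat_algebra_def)
  show "(\<lambda>x. w x * F (\<lambda>i. x (i + 1)) * mat_adjoint (w x)) \<in> ?S"
    by (intro mult adj tr w F)
qed

text \<open>An invariant \<open>F\<close> is a constant \<open>A\<close> with A = w(x) A w(x)^*
  almost everywhere. The letters \<open>s\<close> and \<open>t\<close> have positive mass and lie on
  the two sides of the partition, so both values of \<open>w\<close> occur in this equation, and
  \<open>A\<close> commutes with the clock and the shift matrix.\<close>

lemma fixed_points_beta:
  fixes \<mu>1 :: "'a measure" and n :: nat and C1 :: "'a set"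
  assumes \<mu>1: "prob_space \<mu>1" and n: "n > 0" and C1: "C1 \<in> sets \<mu>1"
    and s: "s \<in> C1" "{s} \<in> sets \<mu>1" "measure \<mu>1 {s} > 0"
    and t: "t \<notin> C1" "{t} \<in> sets \<mu>1" "measure \<mu>1 {t} > 0"
    and C: "C = {x \<in> space (bernoulli \<mu>1). x 0 \<in> C1}" and D: "D = space (bernoulli \<mu>1) - C"
  shows "fixed_points (Linf_mat (bernoulli \<mu>1) n) (beta \<mu>1 n C D) = scalars (Linf_mat (bernoulli \<mu>1) n)"
proof -
  let ?M = "bernoulli \<mu>1"
  have "(\<lambda>x. x 0) \<in> ?M \<rightarrow>\<^sub>M \<mu>1" unfolding bernoulli_def by simp
  from measurable_sets[OF this C1] have C_sets: "C \<in> sets ?M"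
    by (simp add: C vimage_def Int_def conj_commute)
  define w where "w = (\<lambda>x. if x \<in> C then mat_adjoint (clock_mat n) else mat_adjoint (shift_mat n))"
  have w_carrier: "w x \<in> carrier_mat n n" for x
    using mat_adjoint_carrier[OF clock_mat_carrier[of n]] mat_adjoint_carrier[OF shift_mat_carrier[of n]]
    by (simp add: w_def)
  have w_unitary: "w x * mat_adjoint (w x) = 1\<^sub>m n" for x
    by (simp add: w_def mat_adjoint_adjoint[OF clock_mat_carrier]
        mat_adjoint_adjoint[OF shift_mat_carrier] clock_mat_unitary shift_mat_unitary)
  have w_local: "(\<lambda>x. w x $$ (a, b)) \<in> local_functions \<mu>1 {0}" if ab: "a < n" "b < n" for a b
  proof (rule local_functionsI)
    have "(\<lambda>x. w x $$ (a, b)) \<in> Linf_fun ?M"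
      using Linf_mat_fun_entry[OF cocycle_unitary_class(2)[OF C_sets D] ab] unfolding w_def .
    then show "(\<lambda>x. w x $$ (a, b)) \<in> borel_measurable ?M" by (simp add: Linf_fun_def)
    show "norm (w x $$ (a, b)) \<le> 1" for x
      by (rule norm_unitary_index_le[OF w_carrier w_unitary ab])
    show "w x $$ (a, b) = w y $$ (a, b)"
      if "x \<in> space ?M" "y \<in> space ?M" "\<And>i. i \<in> {0} \<Longrightarrow> x i = y i" for x y
      using that(1,2) that(3)[of 0] by (simp add: w_def C)
  qed
  show ?thesis
    unfolding Linf_mat_def
  proof (rule fixed_points_ae_algebra_eq_scalars[where
        \<Phi> = "\<lambda>F x. w x * F (\<lambda>i. x (i + 1)) * mat_adjoint (w x)"])
    show "pointwise_closed (Linf_mat_fun ?M n) (mat_algebra n)" by (rule pointwise_closed_Linf_mat)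
    show "star_automorphism (ae_algebra ?M (Linf_mat_fun ?M n) (mat_algebra n)) (beta \<mu>1 n C D)"
      using star_automorphism_beta[OF \<mu>1 C_sets D] unfolding Linf_mat_def .
    fix F assume F: "F \<in> Linf_mat_fun ?M n"
    show "beta \<mu>1 n C D (Linf_mat_class ?M n F) =
        Linf_mat_class ?M n (\<lambda>x. w x * F (\<lambda>i. x (i + 1)) * mat_adjoint (w x)) \<and>
        (\<lambda>x. w x * F (\<lambda>i. x (i + 1)) * mat_adjoint (w x)) \<in> Linf_mat_fun ?M n"
      unfolding w_def by (intro conjI beta_class[OF \<mu>1 C_sets D F])
    assume inv: "AE x in ?M. F x = w x * F (\<lambda>i. x (i + 1)) * mat_adjoint (w x)"
    interpret unitary_cocycle \<mu>1 n w F
      by (rule unitary_cocycle.intro[OF \<mu>1 w_carrier w_unitary w_local F inv])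
    obtain A where A: "A \<in> carrier_mat n n" "AE x in ?M. F x = A" by (rule F_constant)
    have AE_A: "AE x in ?M. A = w x * A * mat_adjoint (w x)"
      using inv A(2) AE_translate[OF \<mu>1 A(2), of 1] by eventually_elim simp
    have "mat_adjoint (clock_mat n) * A * clock_mat n = A"
    proof -
      from AE_bernoulli_obtain_coordinate[OF \<mu>1 s(2,3) AE_A] obtain x
        where "x \<in> space ?M" "x 0 = s" "A = w x * A * mat_adjoint (w x)" .
      with s(1) show ?thesis by (simp add: w_def C mat_adjoint_adjoint[OF clock_mat_carrier])
    qed
    \<comment> \<open>The cocycle takes the adjoint matrices as values; conjugating back turns
      invariance under the adjoint into invariance under the matrix itself.\<close>
    with unitary_conj(6)[OF clock_mat_carrier clock_mat_unitary A(1) A(1)]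
    have u: "clock_mat n * A * mat_adjoint (clock_mat n) = A" by simp
    have "mat_adjoint (shift_mat n) * A * shift_mat n = A"
    proof -
      from AE_bernoulli_obtain_coordinate[OF \<mu>1 t(2,3) AE_A] obtain x
        where "x \<in> space ?M" "x 0 = t" "A = w x * A * mat_adjoint (w x)" .
      with t(1) show ?thesis by (simp add: w_def C mat_adjoint_adjoint[OF shift_mat_carrier])
    qed
    with unitary_conj(6)[OF shift_mat_carrier shift_mat_unitary A(1) A(1)]
    have v: "shift_mat n * A * mat_adjoint (shift_mat n) = A" by simp
    from clock_shift_commutant[OF A(1) n u v] obtain c where "A = c \<cdot>\<^sub>m 1\<^sub>m n" .
    with A(2) show "\<exists>c. AE x in ?M. F x = c \<odot>\<^bsub>mat_algebra n\<^esub> \<one>\<^bsub>mat_algebra n\<^esub>"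
      by (auto simp: mat_algebra_def)
  qed
qed

theorem proposition4p5:
  fixes \<Lambda> :: "'a set" and \<mu>1 :: "'a measure"
    and X :: "(int \<Rightarrow> 'a) set" and \<mu> :: "(int \<Rightarrow> 'a) measure"
  assumes "finite \<Lambda>" and "card \<Lambda> > 1"
    and "X = (UNIV \<rightarrow> \<Lambda>)"
    and "prob_space \<mu>1" and "space \<mu>1 = \<Lambda>" and "sets \<mu>1 = Pow \<Lambda>"
    and "\<forall>l\<in>\<Lambda>. measure \<mu>1 {l} > 0"
    and "\<mu> = bernoulli \<mu>1"
  shows "fixed_points (Linf \<mu>) (alpha \<mu>1) = scalars (Linf \<mu>) \<and>
    (\<forall>(n::nat) C1 C D.
       n > 1 \<and> C1 \<noteq> {} \<and> C1 \<subset> \<Lambda> \<and> C = {x \<in> X. x 0 \<in> C1} \<and> D = X - C \<longrightarrow>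
       fixed_points (Linf_mat \<mu> n) (beta \<mu>1 n C D) = scalars (Linf_mat \<mu> n))"
proof (intro conjI allI impI)
  show "fixed_points (Linf \<mu>) (alpha \<mu>1) = scalars (Linf \<mu>)"
    unfolding assms(8) by (rule fixed_points_alpha[OF assms(4)])
next
  fix n :: nat and C1 C D
  assume *: "n > 1 \<and> C1 \<noteq> {} \<and> C1 \<subset> \<Lambda> \<and> C = {x \<in> X. x 0 \<in> C1} \<and> D = X - C"
  \<comment> \<open>Non-emptiness of \<open>C1\<close> supplies \<open>s\<close>, properness
    supplies \<open>t\<close>.\<close>
  then obtain s t where st: "s \<in> C1" "s \<in> \<Lambda>" "t \<in> \<Lambda>" "t \<notin> C1" by blast
  have X: "X = space (bernoulli \<mu>1)" by (simp add: assms(3,5) space_bernoulli)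
  show "fixed_points (Linf_mat \<mu> n) (beta \<mu>1 n C D) = scalars (Linf_mat \<mu> n)"
    unfolding assms(8)
    by (rule fixed_points_beta[OF assms(4), of n C1 s t]) (use * st assms(6,7) X in auto)
qed

end
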